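(* Assume hypothesis (H) of the context, and let $\Psi:\mathbb R\times\mathbb R^n\to\mathbb R^n$ be the map defined in the context. Let $\phi\in\mathcal C$ and let $x(\cdot;0,\phi):[-r,+\infty)\to\mathbb R^n$ be the solution of $$\frac{d}{dt}\{x(t)-L(t)x_t\}=F(t,x_t)$$ with $x_0=\phi$. Then there exists a unique $\xi\in\mathbb R^n$ such that $$\sup_{t\ge0}|x(t;0,\phi)-\Psi(t,\xi)|e^{\lambda t}<+\infty.$$
   Context: $|\cdot|$ denotes the norm in each space; $\mathbb R^n$ carries a fixed norm, $\mathcal C=C([-r,0],\mathbb R^n)$ carries the supremum norm, and linear and multilinear maps carry operator norms. $x_t\in\mathcal C$ is $x_t(\theta)=x(t+\theta)$, $\theta\in[-r,0]$. $D_2^j$ is the $j$-th partial derivative in the second variable. Hypothesis (H). $n,k\ge1$ are integers, $0<M<1$, and $M_0,\dots,M_{k+1}$ are positive constants. $r_0>0$ and $x^*$ satisfy $0<M_1r_0<H(-\ln M/(k+1))$ and $x^*\in(x_1(r_0),-\ln M/(k+1))\subset(x_1(r_0),x_2(r_0))$, where $H(x)=xe^{-x}-Mx$ and $x_1(r_0)<x_2(r_0)$ are the exactly two positive roots of $H(x)=M_1r_0$ (they exist because $M_1r_0$ is less than the maximum of $H$ on $[0,\infty)$). The delay $r$ and the constant $\lambda$ satisfy $0<r\le r_0$ and $r\lambda=x^*$. For $t\in\mathbb R$, $L(t)\phi=\int_{-r}^0d\eta(t,\theta)\phi(\theta)$ with $\sup_{t\in\mathbb R}|L(t)|=M$, where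 $\eta:\mathbb R\times\mathbb R\to\mathbb R^{n\times n}$ is measurable, $\eta(t,\theta)=\eta(t,-r)$ for $\theta\le-r$, $\eta(t,\theta)=0$ for $\theta\ge0$, $\eta(t,\cdot)$ is continuous from the left on $(-r,0)$ and of bounded variation uniformly in $t$, such that $t\mapsto L(t)\phi$ is continuous for each $\phi\in\mathcal C$; and $\eta$ is uniformly nonatomic at zero (for every $\epsilon>0$ there is $\delta'>0$ such that the total variation of $\eta(t,\cdot)$ on $[-\delta',0]$ is less than $\epsilon$ for all $t$). $F:\mathbb R\times\mathcal C\to\mathbb R^n$ is continuous, $C^k$ in the second variable, and for all $t\in\mathbb R$, $\phi,\psi\in\mathcal C$: $|F(t,0)|\le M_0e^{\lambda|t|}$, $|D_2^jF(t,\phi)|\le M_j$ for $j=1,\dots,k$, $|D_2^kF(t,\phi)-D_2^kF(t,\psi)|\le M_{k+1}|\phi-\psi|$. Solutions: under (H) the Cauchy problem is well posed; $x(\cdot;0,\phi)$ is the unique continuous map on $[-r,\infty)$ with $x_0=\phi$ such that $x(t)-L(t)x_t$ is continuously differentiable and satisfies the equation on $[0,\infty)$. A solution on $\mathbb R$ is a continuous $y:\mathbb R\to\mathbb R^n$ with $y(t)-L(t)y_t$ continuously differentiable and satisfying the equation for all $t\in\mathbb R$. The map $\Psi$: under (H), for each $\xi\in\mathbb R^n$ there is a unique solution $y$ on $\mathbb R$ with $y(0)-L(0)y_0=\xi$ and $\sup_{t\le0}|y(t)|e^{\lambda t}<+\infty$; $\Psi(\cdot,\xi)$ denotes this solution.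 *)

theory Defs
  imports "HOL-Analysis.Analysis"
begin

text \<open>
  The space \<open>C([-r,0], X)\<close> with the supremum norm is represented isometrically by the subspace of
  those bounded continuous functions on the real line that are constant on \<open>(-\<infinity>,-r]\<close> and on
  \<open>[0,\<infinity>)\<close>. In this way \<open>r\<close> remains an ordinary real variable, and \<open>norm\<close> is the supremum norm.
\<close>

definition Cspace :: "real \<Rightarrow> (real \<Rightarrow>\<^sub>C 'a::banach) set" where
  "Cspace r = {\<phi>. ext_cont (apply_bcontfun \<phi>) (-r) 0 = apply_bcontfun \<phi>}"

definition seg :: "real \<Rightarrow> (real \<Rightarrow> 'a::banach) \<Rightarrow> real \<Rightarrow> (real \<Rightarrow>\<^sub>C 'a)" where
  "seg r x t = Bcontfun (ext_cont (\<lambda>\<theta>. x (t + \<theta>)) (-r) 0)"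

definition total_variation :: "(real \<Rightarrow> 'b::real_normed_vector) \<Rightarrow> real \<Rightarrow> real \<Rightarrow> ennreal" where
  "total_variation g a b =
     (SUP P\<in>{P. P division_of {a..b}}. ennreal (\<Sum>K\<in>P. norm (g (Sup K) - g (Inf K))))"

text \<open>\<open>I = \<integral>\<^sub>a\<^sup>b d\<eta>(\<theta>) f(\<theta>)\<close> as a limit of Riemann--Stieltjes sums when the mesh tends to \<open>0\<close>.\<close>

definition has_stieltjes_integral ::
    "(real \<Rightarrow> 'a::banach \<Rightarrow>\<^sub>L 'a) \<Rightarrow> (real \<Rightarrow> 'a) \<Rightarrow> real \<Rightarrow> real \<Rightarrow> 'a \<Rightarrow> bool" where
  "has_stieltjes_integral g f a b I \<longleftrightarrow>
     (\<forall>\<epsilon>>0. \<exists>\<delta>>0. \<forall>p. p tagged_division_of {a..b} \<and> (\<lambda>\<theta>. ball \<theta> \<delta>) fine p \<longrightarrow>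
        norm ((\<Sum>(\<theta>, K)\<in>p. blinfun_apply (g (Sup K) - g (Inf K)) (f \<theta>)) - I) < \<epsilon>)"

text \<open>Operator norms over a subspace \<open>S\<close>, with value \<open>\<infinity>\<close> for unbounded maps. A \<open>j\<close>-linear map
  is represented by a function of lists of length \<open>j\<close>.\<close>

definition opnorm_on :: "'c::real_normed_vector set \<Rightarrow> ('c \<Rightarrow> 'b::real_normed_vector) \<Rightarrow> ennreal" where
  "opnorm_on S f = (SUP v\<in>{v\<in>S. norm v \<le> 1}. ennreal (norm (f v)))"

definition multilinear_on ::
    "'c::real_normed_vector set \<Rightarrow> nat \<Rightarrow> ('c list \<Rightarrow> 'b::real_normed_vector) \<Rightarrow> bool" where
  "multilinear_on S j f \<longleftrightarrow>
     (\<forall>us ws. set us \<subseteq> S \<and> set ws \<subseteq> S \<and> length us + 1 + length ws = j \<longrightarrow>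
        (\<forall>v\<in>S. \<forall>w\<in>S. \<forall>a b.
           f (us @ (a *\<^sub>R v + b *\<^sub>R w) # ws) = a *\<^sub>R f (us @ v # ws) + b *\<^sub>R f (us @ w # ws)))"

definition multi_opnorm_on ::
    "'c::real_normed_vector set \<Rightarrow> nat \<Rightarrow> ('c list \<Rightarrow> 'b::real_normed_vector) \<Rightarrow> ennreal" where
  "multi_opnorm_on S j f =
     (SUP vs\<in>{vs. length vs = j \<and> set vs \<subseteq> {v\<in>S. norm v \<le> 1}}. ennreal (norm (f vs)))"

text \<open>\<open>f\<close> is of class \<open>C\<^sup>k\<close> on the normed space \<open>S\<close> and \<open>D j\<close>, for \<open>j \<le> k\<close>, is its \<open>j\<close>-th
  Frechet derivative: \<open>D (Suc j)\<close> is the derivative, in the operator norm, of the map \<open>D j\<close> with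
  values in the bounded \<open>j\<close>-linear maps, the new direction being the first argument. Only the values
  of \<open>D j \<phi>\<close> on lists of length \<open>j\<close> matter, and on \<open>S\<close> they are determined by \<open>f\<close>.\<close>

definition Ck_with_derivs ::
    "'c::real_normed_vector set \<Rightarrow> nat \<Rightarrow> ('c \<Rightarrow> 'b::real_normed_vector)
      \<Rightarrow> (nat \<Rightarrow> 'c \<Rightarrow> 'c list \<Rightarrow> 'b) \<Rightarrow> bool" where
  "Ck_with_derivs S k f D \<longleftrightarrow>
     (\<forall>\<phi>\<in>S. D 0 \<phi> [] = f \<phi>) \<and>
     (\<forall>j\<le>k. \<forall>\<phi>\<in>S. multilinear_on S j (D j \<phi>) \<and> multi_opnorm_on S j (D j \<phi>) < \<infinity>) \<and>
     (\<forall>j<k. \<forall>\<phi>\<in>S. \<forall>\<epsilon>>0. \<exists>\<delta>>0. \<forall>h\<in>S. norm h < \<delta> \<longrightarrow>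
        multi_opnorm_on S j (\<lambda>vs. D j (\<phi> + h) vs - D j \<phi> vs - D (Suc j) \<phi> (h # vs))
          \<le> ennreal (\<epsilon> * norm h)) \<and>
     (\<forall>\<phi>\<in>S. \<forall>\<epsilon>>0. \<exists>\<delta>>0. \<forall>\<psi>\<in>S. norm (\<psi> - \<phi>) < \<delta> \<longrightarrow>
        multi_opnorm_on S k (\<lambda>vs. D k \<psi> vs - D k \<phi> vs) < ennreal \<epsilon>)"

definition Hfun :: "real \<Rightarrow> real \<Rightarrow> real" where
  "Hfun M x = x * exp (- x) - M * x"

text \<open>
  Hypothesis (H). \<open>\<real>\<^sup>n\<close> with an arbitrary fixed norm is a type \<open>'a\<close> of real dimension \<open>n \<ge> 1\<close>
  (\<open>dim\<close> is \<open>0\<close> for infinite-dimensional spaces, so this forces finite dimension, and then the sort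
  \<open>banach\<close> is no restriction); matrices are elements of \<open>'a \<Rightarrow>\<^sub>L 'a\<close>. The constants \<open>M\<^sub>j\<close> are \<open>Mc j\<close>,
  the roots \<open>x\<^sub>1(r\<^sub>0)\<close>, \<open>x\<^sub>2(r\<^sub>0)\<close> are \<open>x1\<close>, \<open>x2\<close>, and \<open>D j t \<phi>\<close> is \<open>D\<^sub>2\<^sup>jF(t,\<phi>)\<close>.
\<close>

locale hypothesis_H =
  fixes n k :: nat and M :: real and Mc :: "nat \<Rightarrow> real"
    and r0 x1 x2 xstar r lam :: real
    and \<eta> :: "real \<Rightarrow> real \<Rightarrow> ('a::banach \<Rightarrow>\<^sub>L 'a)"
    and L :: "real \<Rightarrow> (real \<Rightarrow>\<^sub>C 'a) \<Rightarrow> 'a"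
    and F :: "real \<Rightarrow> (real \<Rightarrow>\<^sub>C 'a) \<Rightarrow> 'a"
    and D :: "nat \<Rightarrow> real \<Rightarrow> (real \<Rightarrow>\<^sub>C 'a) \<Rightarrow> (real \<Rightarrow>\<^sub>C 'a) list \<Rightarrow> 'a"
  assumes n_ge_1: "n \<ge> 1" and dim_n: "dim (UNIV :: 'a set) = n"
    and k_ge_1: "k \<ge> 1"
    and M_range: "0 < M" "M < 1"
    and Mc_pos: "\<And>j. j \<le> k + 1 \<Longrightarrow> Mc j > 0"
    and r0_pos: "r0 > 0"
    and r0_small: "0 < Mc 1 * r0" "Mc 1 * r0 < Hfun M (- ln M / (real k + 1))"
    and roots: "{x. x > 0 \<and> Hfun M x = Mc 1 * r0} = {x1, x2}" "x1 < x2"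
    and xstar_range: "xstar \<in> {x1<..< - ln M / (real k + 1)}"
      "{x1<..< - ln M / (real k + 1)} \<subset> {x1<..<x2}"
    and r_range: "0 < r" "r \<le> r0" and lam: "r * lam = xstar"
    and \<eta>_measurable: "(\<lambda>(t, \<theta>). \<eta> t \<theta>) \<in> borel_measurable (lebesgue :: (real \<times> real) measure)"
    and \<eta>_left: "\<And>t \<theta>. \<theta> \<le> - r \<Longrightarrow> \<eta> t \<theta> = \<eta> t (- r)"
    and \<eta>_right: "\<And>t \<theta>. \<theta> \<ge> 0 \<Longrightarrow> \<eta> t \<theta> = 0"
    and \<eta>_left_continuous: "\<And>t \<theta>. \<theta> \<in> {- r<..<0} \<Longrightarrow> continuous (at_left \<theta>) (\<eta> t)"
    and \<eta>_bounded_variation: "\<exists>V::real. \<forall>t. total_variation (\<eta> t) (- r) 0 \<le> ennreal V"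
    and \<eta>_nonatomic:
      "\<And>\<epsilon>::real. \<epsilon> > 0 \<Longrightarrow> \<exists>\<delta>>0. \<forall>t. total_variation (\<eta> t) (- \<delta>) 0 < ennreal \<epsilon>"
    and L_integral:
      "\<And>t \<phi>. \<phi> \<in> Cspace r \<Longrightarrow> has_stieltjes_integral (\<eta> t) (apply_bcontfun \<phi>) (- r) 0 (L t \<phi>)"
    and L_norm: "(SUP t. opnorm_on (Cspace r) (L t)) = ennreal M"
    and L_continuous: "\<And>\<phi>. \<phi> \<in> Cspace r \<Longrightarrow> continuous_on UNIV (\<lambda>t. L t \<phi>)"
    and F_continuous: "continuous_on (UNIV \<times> Cspace r) (\<lambda>(t, \<phi>). F t \<phi>)"
    and F_Ck: "\<And>t. Ck_with_derivs (Cspace r) k (F t) (\<lambda>j. D j t)"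
    and F_zero: "\<And>t. norm (F t 0) \<le> Mc 0 * exp (lam * \<bar>t\<bar>)"
    and F_derivs: "\<And>j t \<phi>. 1 \<le> j \<Longrightarrow> j \<le> k \<Longrightarrow> \<phi> \<in> Cspace r \<Longrightarrow>
      multi_opnorm_on (Cspace r) j (D j t \<phi>) \<le> ennreal (Mc j)"
    and F_lipschitz: "\<And>t \<phi> \<psi>. \<phi> \<in> Cspace r \<Longrightarrow> \<psi> \<in> Cspace r \<Longrightarrow>
      multi_opnorm_on (Cspace r) k (\<lambda>vs. D k t \<phi> vs - D k t \<psi> vs)
        \<le> ennreal (Mc (k + 1) * norm (\<phi> - \<psi>))"

text \<open>On \<open>T\<close>, the map \<open>t \<mapsto> x(t) - L(t)x\<^sub>t\<close> is continuously differentiable (one-sidedly at an end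
  point of \<open>T\<close>) with derivative \<open>F(t,x\<^sub>t)\<close>.\<close>

definition satisfies_eq_on ::
    "real \<Rightarrow> (real \<Rightarrow> (real \<Rightarrow>\<^sub>C 'a::banach) \<Rightarrow> 'a) \<Rightarrow> (real \<Rightarrow> (real \<Rightarrow>\<^sub>C 'a) \<Rightarrow> 'a)
      \<Rightarrow> real set \<Rightarrow> (real \<Rightarrow> 'a) \<Rightarrow> bool" where
  "satisfies_eq_on r L F T x \<longleftrightarrow>
     (\<forall>t\<in>T. ((\<lambda>s. x s - L s (seg r x s)) has_vector_derivative F t (seg r x t)) (at t within T)) \<and>
     continuous_on T (\<lambda>t. F t (seg r x t))"

definition solution_from ::
    "real \<Rightarrow> (real \<Rightarrow> (real \<Rightarrow>\<^sub>C 'a::banach) \<Rightarrow> 'a) \<Rightarrow> (real \<Rightarrow> (real \<Rightarrow>\<^sub>C 'a) \<Rightarrow> 'a)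
      \<Rightarrow> (real \<Rightarrow>\<^sub>C 'a) \<Rightarrow> (real \<Rightarrow> 'a) \<Rightarrow> bool" where
  "solution_from r L F \<phi> x \<longleftrightarrow>
     continuous_on {- r..} x \<and> seg r x 0 = \<phi> \<and> satisfies_eq_on r L F {0..} x"

definition solution_on_line ::
    "real \<Rightarrow> (real \<Rightarrow> (real \<Rightarrow>\<^sub>C 'a::banach) \<Rightarrow> 'a) \<Rightarrow> (real \<Rightarrow> (real \<Rightarrow>\<^sub>C 'a) \<Rightarrow> 'a)
      \<Rightarrow> (real \<Rightarrow> 'a) \<Rightarrow> bool" where
  "solution_on_line r L F y \<longleftrightarrow> continuous_on UNIV y \<and> satisfies_eq_on r L F UNIV y"

definition Psi ::
    "real \<Rightarrow> real \<Rightarrow> (real \<Rightarrow> (real \<Rightarrow>\<^sub>C 'a::banach) \<Rightarrow> 'a) \<Rightarrow> (real \<Rightarrow> (real \<Rightarrow>\<^sub>C 'a) \<Rightarrow> 'a)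
      \<Rightarrow> real \<Rightarrow> 'a \<Rightarrow> 'a" where
  "Psi r lam L F t \<xi> =
     (THE y. solution_on_line r L F y \<and> y 0 - L 0 (seg r y 0) = \<xi> \<and>
             bdd_above ((\<lambda>t. norm (y t) * exp (lam * t)) ` {..0})) t"

end

theory Submission
  imports Defs
begin

text \<open>
  Everything rests on one number. Since \<open>H\<close> stays above \<open>M\<^sub>1 r\<^sub>0\<close> between its two roots,
  \<open>r \<lambda> = x\<^sup>*\<close> gives \<open>q = e\<^bsup>\<lambda>r\<^esup> (M + M\<^sub>1 / \<lambda>) < 1\<close>. Suppose that a weight \<open>w > 0\<close> is at most
  \<open>e\<^bsup>\<lambda>r\<^esup> w(t)\<close> on the delay interval \<open>[t - r, t]\<close>, for every \<open>t\<close>, and that a function bounded by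
  \<open>C w\<close> has a suitably normalised primitive bounded by \<open>C w / \<lambda>\<close>. Then a perturbation of size
  \<open>\<le> w\<close> changes \<open>L(t)y\<^sub>t\<close> by at most \<open>M e\<^bsup>\<lambda>r\<^esup> w(t)\<close>, and the primitive of \<open>F(t,y\<^sub>t)\<close> by at most
  \<open>(M\<^sub>1 e\<^bsup>\<lambda>r\<^esup> / \<lambda>) w(t)\<close>, so that the integrated equation is a contraction with constant \<open>q\<close> for the
  norm \<open>sup |z| / w\<close>. Banach's theorem gives existence (\<open>weighted_perturbation_exists\<close>), and
  iterating the estimate gives uniqueness (\<open>weighted_difference_vanishes\<close>). Two weights are used.

  With \<open>w(t) = e\<^bsup>\<lambda>|t|\<^esup>\<close> and primitives that vanish at \<open>0\<close>, the contraction shows that \<open>\<Psi>(\<cdot>,\<xi>)\<close> exists.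
  The uniqueness estimate on the half lines \<open>(-\<infinity>,T]\<close>, where every competitor is weighted-bounded
  whatever its growth in the future, shows that it is unique.

  With \<open>w(t) = e\<^bsup>-\<lambda>t\<^esup>\<close> and primitives that vanish at \<open>+\<infinity>\<close>, one looks for a solution \<open>y = x + z\<close> on the
  line, where \<open>x\<close> is extended to the left by a constant. The correction \<open>z\<close> solves
  \<open>z(t) = L(t)z\<^sub>t + c(t) - \<integral>\<^sub>t\<^sup>\<infinity> (F(s,x\<^sub>s+z\<^sub>s) - F(s,x\<^sub>s)) ds\<close>, where \<open>c\<close> measures how far the extended
  \<open>x\<close> is from a solution and vanishes for \<open>t \<ge> 0\<close>. The bound \<open>|z| \<le> B w\<close> says both that \<open>y\<close> approaches
  \<open>x\<close> at the rate \<open>e\<^bsup>-\<lambda>t\<^esup>\<close> as \<open>t \<rightarrow> \<infinity>\<close> and that \<open>y\<close> grows at most like \<open>e\<^bsup>-\<lambda>t\<^esup>\<close> as \<open>t \<rightarrow> -\<infinity>\<close>, so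
  \<open>y = \<Psi>(\<cdot>,\<xi>)\<close> with \<open>\<xi> = y(0) - L(0)y\<^sub>0\<close>. If \<open>\<Psi>(\<cdot>,\<xi>')\<close> approaches \<open>x\<close> as well, then the difference
  of the two solutions is bounded by a multiple of \<open>w\<close> on the whole line, and the uniqueness
  estimate makes it zero.
\<close>

section \<open>Segments\<close>

lemma clamp_real: "a \<le> b \<Longrightarrow> clamp a b (x::real) \<in> {a..b}"
  using clamp_in_interval[of a b x] by simp

lemma apply_seg:
  fixes x :: "real \<Rightarrow> 'a::banach"
  assumes "0 < r" and x: "continuous_on {t - r..t} x"
  shows "apply_bcontfun (seg r x t) \<theta> = x (t + clamp (- r) 0 \<theta>)"
proof -
  have c: "continuous_on (cbox (- r) 0) (\<lambda>\<theta>. x (t + \<theta>))"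
    by (rule continuous_on_compose2[OF x]) (auto intro!: continuous_intros)
  have "bounded (range (\<lambda>\<theta>. x (t + clamp (- r) 0 \<theta>)))"
    by (intro clamp_bounded compact_imp_bounded compact_continuous_image[OF c]) simp
  then have "ext_cont (\<lambda>\<theta>. x (t + \<theta>)) (- r) 0 \<in> bcontfun"
    using c by (auto simp: bcontfun_def ext_cont_def intro: clamp_continuous_on)
  then show ?thesis
    by (simp add: seg_def Bcontfun_inverse ext_cont_def)
qed

lemma seg_in_Cspace:
  fixes x :: "real \<Rightarrow> 'a::banach"
  assumes "0 < r" and "continuous_on {t - r..t} x"
  shows "seg r x t \<in> Cspace r"
proof -
  have "clamp (- r) 0 (clamp (- r) 0 \<theta>) = clamp (- r) 0 \<theta>" for \<theta> :: real
    using clamp_real[of "- r" 0 \<theta>] assms by simp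
  then show ?thesis
    unfolding Cspace_def by (auto simp: ext_cont_def apply_seg[OF assms])
qed

lemma Cspace_combine:
  "\<phi> \<in> Cspace r \<Longrightarrow> \<psi> \<in> Cspace r \<Longrightarrow> a *\<^sub>R \<phi> + b *\<^sub>R \<psi> \<in> Cspace r"
  by (auto simp: Cspace_def ext_cont_def fun_eq_iff)

lemma Cspace_diff: "\<phi> \<in> Cspace r \<Longrightarrow> \<psi> \<in> Cspace r \<Longrightarrow> \<phi> - \<psi> \<in> Cspace r"
  using Cspace_combine[of \<phi> r \<psi> 1 "- 1"] by simp

lemma norm_seg_le:
  fixes x :: "real \<Rightarrow> 'a::banach"
  assumes "0 < r" and "continuous_on {t - r..t} x"
    and "\<And>s. t - r \<le> s \<Longrightarrow> s \<le> t \<Longrightarrow> norm (x s) \<le> C"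
  shows "norm (seg r x t) \<le> C"
proof (rule norm_bound)
  fix \<theta> :: real
  show "norm (apply_bcontfun (seg r x t) \<theta>) \<le> C"
    unfolding apply_seg[OF assms(1,2)]
    using clamp_real[of "- r" 0 \<theta>] assms(1) by (intro assms(3)) auto
qed

lemma seg_minus:
  fixes x y :: "real \<Rightarrow> 'a::banach"
  assumes "0 < r" and "continuous_on {t - r..t} x" and "continuous_on {t - r..t} y"
  shows "seg r (\<lambda>s. x s - y s) t = seg r x t - seg r y t"
  by (rule bcontfun_eqI) (simp add: apply_seg assms continuous_on_diff)

lemma seg_cong:
  assumes "0 < r" and "\<And>s. t - r \<le> s \<Longrightarrow> s \<le> t \<Longrightarrow> x s = y s"
  shows "seg r x t = seg r y t"
proof -
  have "ext_cont (\<lambda>\<theta>. x (t + \<theta>)) (- r) 0 = ext_cont (\<lambda>\<theta>. y (t + \<theta>)) (- r) 0"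
    unfolding ext_cont_def
  proof
    fix \<theta> :: real
    show "x (t + clamp (- r) 0 \<theta>) = y (t + clamp (- r) 0 \<theta>)"
      using clamp_real[of "- r" 0 \<theta>] assms(1) by (intro assms(2)) auto
  qed
  then show ?thesis by (simp add: seg_def)
qed

text \<open>
  The segments that end near \<open>t\<close> only involve times in a compact interval, where \<open>x\<close> is uniformly
  continuous; this makes the convergence uniform in \<open>\<theta>\<close>.
\<close>

lemma continuous_on_seg:
  fixes x :: "real \<Rightarrow> 'a::banach"
  assumes r: "0 < r" and x: "continuous_on UNIV x"
  shows "continuous_on UNIV (seg r x)"
proof (simp add: continuous_on_iff, intro allI impI)
  fix t and e :: real assume e: "0 < e"
  have "uniformly_continuous_on {t - r - 1..t + 1} x"
    using x by (intro compact_uniformly_continuous) (auto intro: continuous_on_subset)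
  then obtain d where d: "d > 0"
    "\<And>s s'. s \<in> {t - r - 1..t + 1} \<Longrightarrow> s' \<in> {t - r - 1..t + 1} \<Longrightarrow> dist s' s < d
       \<Longrightarrow> dist (x s') (x s) < e / 2"
    unfolding uniformly_continuous_on_def using e by (metis half_gt_zero)
  have sub: "continuous_on {s - r..s} x" for s
    using x by (rule continuous_on_subset) simp
  show "\<exists>d>0. \<forall>t'. dist t' t < d \<longrightarrow> dist (seg r x t') (seg r x t) < e"
  proof (intro exI[of _ "min d 1"] conjI allI impI)
    fix t' assume t': "dist t' t < min d 1"
    have "dist (seg r x t') (seg r x t) \<le> e / 2"
    proof (rule dist_bound)
      fix \<theta> :: real
      have "dist (x (t' + clamp (- r) 0 \<theta>)) (x (t + clamp (- r) 0 \<theta>)) < e / 2"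
        using clamp_real[of "- r" 0 \<theta>] r t' by (intro d(2)) (auto simp: dist_real_def)
      then show "dist (apply_bcontfun (seg r x t') \<theta>) (apply_bcontfun (seg r x t) \<theta>) \<le> e / 2"
        by (simp add: apply_seg[OF r sub])
    qed
    then show "dist (seg r x t') (seg r x t) < e" using e by linarith
  qed (use d in auto)
qed

section \<open>Primitives of exponentially weighted functions\<close>

lemma primitive_exists:
  fixes f :: "real \<Rightarrow> 'a::banach"
  assumes f: "continuous_on UNIV f"
  obtains g where "g 0 = 0" and "\<And>t. (g has_vector_derivative f t) (at t)"
proof -
  let ?g = "\<lambda>t. integral {0..t} f - integral {t..0} f"
  have "(?g has_vector_derivative f t) (at t)" for t
  proof -
    \<comment> \<open>Near \<open>t\<close> the two-sided integral differs by a constant from one with the fixed base point \<open>-R\<close>.\<close>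
    define R where "R = \<bar>t\<bar> + 1"
    have int: "f integrable_on {a..b}" for a b
      using f by (intro integrable_continuous_real) (auto intro: continuous_on_subset)
    have g: "?g s = integral {- R..s} f - integral {- R..0} f" if "s \<in> {- R<..<R}" for s
    proof (cases "0 \<le> s")
      case True
      then have "integral {- R..0} f + integral {0..s} f = integral {- R..s} f"
        using that by (intro Henstock_Kurzweil_Integration.integral_combine int) (auto simp: R_def)
      moreover have "integral {s..0} f = 0"
        using True by (cases "s = 0") auto
      ultimately show ?thesis by (simp add: algebra_simps)
    next
      case False
      then have "integral {- R..s} f + integral {s..0} f = integral {- R..0} f"
        using that by (intro Henstock_Kurzweil_Integration.integral_combine int) (auto simp: R_def)
      then show ?thesis using False by (simp add: algebra_simps)
    qed
    have t: "t \<in> {- R<..<R}" by (auto simp: R_def)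
    have "((\<lambda>s. integral {- R..s} f) has_vector_derivative f t) (at t within {- R..R})"
      using f t by (intro integral_has_vector_derivative) (auto intro: continuous_on_subset)
    then have "((\<lambda>s. integral {- R..s} f) has_vector_derivative f t) (at t)"
      using t by (simp add: at_within_Icc_at)
    then have "((\<lambda>s. integral {- R..s} f - integral {- R..0} f) has_vector_derivative f t) (at t)"
      by (auto intro!: derivative_eq_intros)
    then show ?thesis
      by (rule has_vector_derivative_transform_within_open[where S = "{- R<..<R}"])
        (use t g in auto)
  qed
  then show thesis by (intro that[of ?g]) simp_all
qed

text \<open>
  A growing (\<open>\<mu> > 0\<close>) and a decaying (\<open>\<mu> < 0\<close>) exponential majorant are treated at once. For both
  signs the right-hand side is the integral of \<open>C exp (\<mu> u)\<close> over \<open>[s, t]\<close>.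
\<close>

lemma increment_le_exp:
  fixes g :: "real \<Rightarrow> 'a::banach"
  assumes g: "\<And>u. (g has_vector_derivative f u) (at u)"
    and mu: "\<mu> \<noteq> 0" and st: "s \<le> t"
    and f: "\<And>u. s \<le> u \<Longrightarrow> u \<le> t \<Longrightarrow> norm (f u) \<le> C * exp (\<mu> * u)"
  shows "norm (g t - g s) \<le> C / \<mu> * exp (\<mu> * t) - C / \<mu> * exp (\<mu> * s)"
proof (cases "s = t")
  case False
  have "continuous_on UNIV g"
    using g by (meson continuous_at_imp_continuous_on has_vector_derivative_continuous)
  then show ?thesis
    using False st mu
    by (intro differentiable_bound_general[where f' = f and \<phi>' = "\<lambda>u. C * exp (\<mu> * u)"])
      (auto intro!: continuous_intros derivative_eq_intros g f intro: continuous_on_subset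
        simp: has_real_derivative_iff_has_vector_derivative[symmetric])
qed simp

text \<open>
  The majorant integrates to \<open>(C / \<lambda>) (exp (\<lambda> |t|) - 1)\<close> on the segment from \<open>0\<close> to \<open>t\<close>. The bound on
  \<open>f\<close> is asked for on this segment alone, so that the lemma applies to functions that are
  controlled only up to a finite time.
\<close>

lemma primitive_at_0_le:
  fixes g :: "real \<Rightarrow> 'a::banach"
  assumes lam: "0 < lam" and g: "\<And>u. (g has_vector_derivative f u) (at u)" and g0: "g 0 = 0"
    and f: "\<And>u. u \<in> closed_segment 0 t \<Longrightarrow> norm (f u) \<le> C * exp (lam * \<bar>u\<bar>)"
  shows "norm (g t) \<le> C / lam * exp (lam * \<bar>t\<bar>)"
proof -
  have "0 \<le> norm (f 0)" by simp
  also have "norm (f 0) \<le> C" using f[of 0] by simp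
  finally have C: "0 \<le> C / lam" using lam by simp
  show ?thesis
  proof (cases "0 \<le> t")
    case True
    have "norm (g t - g 0) \<le> C / lam * exp (lam * t) - C / lam * exp (lam * 0)"
      using True lam f
      by (intro increment_le_exp[where f = f, OF g]) (force simp: closed_segment_eq_real_ivl)+
    then show ?thesis using True C g0 by simp
  next
    case False
    have "norm (g 0 - g t) \<le> C / - lam * exp (- lam * 0) - C / - lam * exp (- lam * t)"
      using False lam f
      by (intro increment_le_exp[where f = f, OF g]) (force simp: closed_segment_eq_real_ivl)+
    then show ?thesis using False C g0 by simp
  qed
qed

lemma primitive_at_top_le:
  fixes g :: "real \<Rightarrow> 'a::banach"
  assumes lam: "0 < lam" and g: "\<And>u. (g has_vector_derivative f u) (at u)"
    and lim: "(g \<longlongrightarrow> 0) at_top"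
    and f: "\<And>u. t \<le> u \<Longrightarrow> norm (f u) \<le> C * exp (- lam * u)"
  shows "norm (g t) \<le> C / lam * exp (- lam * t)"
proof -
  have "0 \<le> norm (f t)" by simp
  also have "norm (f t) \<le> C * exp (- lam * t)" using f[of t] by simp
  finally have C: "0 \<le> C / lam" using lam by (simp add: zero_le_mult_iff)
  have "norm (g s - g t) \<le> C / lam * exp (- lam * t)" if "t \<le> s" for s
  proof -
    have "norm (g s - g t) \<le> C / - lam * exp (- lam * s) - C / - lam * exp (- lam * t)"
      using that lam f by (intro increment_le_exp[where f = f, OF g]) auto
    moreover have "0 \<le> C / lam * exp (- lam * s)" using C by (rule mult_nonneg_nonneg) simp
    ultimately show ?thesis by simp
  qed
  then have "eventually (\<lambda>s. norm (g s - g t) \<le> C / lam * exp (- lam * t)) at_top"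
    by (auto simp: eventually_at_top_linorder)
  moreover have "((\<lambda>s. norm (g s - g t)) \<longlongrightarrow> norm (0 - g t)) at_top"
    by (intro tendsto_intros lim)
  ultimately show ?thesis
    using tendsto_upperbound by fastforce
qed

lemma tendsto_exp_decay_at_top:
  fixes lam C :: real
  assumes "0 < lam"
  shows "((\<lambda>s. C * exp (- lam * s)) \<longlongrightarrow> 0) at_top"
proof -
  have "filterlim (\<lambda>s. - lam * s) at_bot at_top"
    using assms by (intro filterlim_tendsto_neg_mult_at_bot[OF tendsto_const] filterlim_ident) simp
  then have "((\<lambda>s. exp (- lam * s)) \<longlongrightarrow> 0) at_top"
    by (rule filterlim_compose[OF exp_at_bot])
  then show ?thesis by (rule tendsto_mult_right_zero)
qed

text \<open>
  Subtracting from an arbitrary primitive its limit at \<open>+\<infinity>\<close> replaces the improper integral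
  \<open>- \<integral>\<^sub>t\<^sup>\<infinity> f\<close>; the limit exists because the increments are dominated by a decaying exponential.
\<close>

lemma primitive_at_top_exists:
  fixes f :: "real \<Rightarrow> 'a::banach"
  assumes lam: "0 < lam" and f: "continuous_on UNIV f"
    and bound: "\<And>u. norm (f u) \<le> C * exp (- lam * u)"
  obtains g where "(g \<longlongrightarrow> 0) at_top" and "\<And>t. (g has_vector_derivative f t) (at t)"
proof -
  obtain g where g: "\<And>t. (g has_vector_derivative f t) (at t)"
    using primitive_exists[OF f] by metis
  have "0 \<le> norm (f 0)" by simp
  also have "norm (f 0) \<le> C" using bound[of 0] by simp
  finally have C: "0 \<le> C / lam" using lam by simp
  have inc: "norm (g t - g s) \<le> C / lam * exp (- lam * s)" if "s \<le> t" for s t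
  proof -
    have "norm (g t - g s) \<le> C / - lam * exp (- lam * t) - C / - lam * exp (- lam * s)"
      using that lam bound by (intro increment_le_exp[where f = f, OF g]) auto
    moreover have "0 \<le> C / lam * exp (- lam * t)" using C by (rule mult_nonneg_nonneg) simp
    ultimately show ?thesis by simp
  qed
  note exp0 = tendsto_exp_decay_at_top[OF lam, of "C / lam"]
  have exp_nat: "((\<lambda>n. C / lam * exp (- lam * real n)) \<longlongrightarrow> 0) sequentially"
    by (rule filterlim_compose[OF exp0 filterlim_real_sequentially])
  have "Cauchy (\<lambda>n. g (real n))"
  proof (rule metric_CauchyI)
    fix e :: real assume "0 < e"
    with exp_nat have "eventually (\<lambda>n. C / lam * exp (- lam * real n) < e) sequentially"
      by (rule order_tendstoD(2))
    then obtain N where N: "\<And>n. N \<le> n \<Longrightarrow> C / lam * exp (- lam * real n) < e"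
      by (auto simp: eventually_sequentially)
    have "dist (g (real m)) (g (real n)) < e" if "N \<le> m" "N \<le> n" for m n
    proof (cases "m \<le> n")
      case True
      then show ?thesis using inc[of "real m" "real n"] N[OF that(1)]
        by (simp add: dist_norm norm_minus_commute)
    next
      case False
      then show ?thesis using inc[of "real n" "real m"] N[OF that(2)]
        by (simp add: dist_norm)
    qed
    then show "\<exists>N. \<forall>m\<ge>N. \<forall>n\<ge>N. dist (g (real m)) (g (real n)) < e" by blast
  qed
  then obtain l where l: "(\<lambda>n. g (real n)) \<longlonglongrightarrow> l"
    by (auto simp: Cauchy_convergent_iff convergent_def)
  have "norm (g t - l) \<le> C / lam * exp (- lam * t)" for t
  proof -
    have "eventually (\<lambda>n. norm (g (real n) - g t) \<le> C / lam * exp (- lam * t)) sequentially"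
      using inc by (intro eventually_sequentiallyI[of "nat \<lceil>t\<rceil>"]) (simp add: nat_ceiling_le_eq)
    moreover have "(\<lambda>n. norm (g (real n) - g t)) \<longlonglongrightarrow> norm (l - g t)"
      by (intro tendsto_intros l)
    ultimately have "norm (l - g t) \<le> C / lam * exp (- lam * t)"
      using tendsto_upperbound by fastforce
    then show ?thesis by (simp add: norm_minus_commute)
  qed
  then have "((\<lambda>t. g t - l) \<longlongrightarrow> 0) at_top"
    by (intro Lim_null_comparison[OF _ exp0]) auto
  moreover have "((\<lambda>t. g t - l) has_vector_derivative f t) (at t)" for t
    using g by (auto intro!: derivative_eq_intros)
  ultimately show thesis by (rule that)
qed

section \<open>Neutral equations\<close>

text \<open>
  The setting of the contraction argument, free of the integral representation of \<open>L\<close> and of the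
  derivatives of \<open>F\<close>: \<open>L\<close> is additive, strongly continuous and bounded
  by \<open>M\<close>, \<open>F\<close> is \<open>K\<close>-Lipschitz with exponentially bounded \<open>F(t,0)\<close>, and \<open>gap\<close> is the contraction
  condition.
\<close>

locale neutral_equation =
  fixes M K M0 r lam :: real
    and L F :: "real \<Rightarrow> (real \<Rightarrow>\<^sub>C 'a::banach) \<Rightarrow> 'a"
  assumes r_pos: "0 < r" and lam_pos: "0 < lam"
    and M_nonneg: "0 \<le> M" and K_nonneg: "0 \<le> K"
    and gap: "exp (lam * r) * (M + K / lam) < 1"
    and L_diff: "\<And>t \<phi> \<psi>. \<phi> \<in> Cspace r \<Longrightarrow> \<psi> \<in> Cspace r \<Longrightarrow> L t (\<phi> - \<psi>) = L t \<phi> - L t \<psi>"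
    and L_le: "\<And>t \<phi>. \<phi> \<in> Cspace r \<Longrightarrow> norm (L t \<phi>) \<le> M * norm \<phi>"
    and L_cont: "\<And>\<phi>. \<phi> \<in> Cspace r \<Longrightarrow> continuous_on UNIV (\<lambda>t. L t \<phi>)"
    and F_cont: "continuous_on (UNIV \<times> Cspace r) (\<lambda>(t, \<phi>). F t \<phi>)"
    and F_lip: "\<And>t \<phi> \<psi>. \<phi> \<in> Cspace r \<Longrightarrow> \<psi> \<in> Cspace r \<Longrightarrow>
      norm (F t \<phi> - F t \<psi>) \<le> K * norm (\<phi> - \<psi>)"
    and F_zero_le: "\<And>t. norm (F t 0) \<le> M0 * exp (lam * \<bar>t\<bar>)"
begin

lemma segI [simp]: "continuous_on UNIV x \<Longrightarrow> seg r x t \<in> Cspace r"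
  by (rule seg_in_Cspace[OF r_pos]) (rule continuous_on_subset, auto)

lemma seg_zero [simp]: "seg r (\<lambda>_. 0) t = 0"
  using norm_seg_le[OF r_pos, of t "\<lambda>_. 0" 0] by simp

lemma seg_diff:
  assumes "continuous_on UNIV x" "continuous_on UNIV y"
  shows "seg r (\<lambda>s. x s - y s) t = seg r x t - seg r y t"
  using assms by (intro seg_minus[OF r_pos]) (auto intro: continuous_on_subset)

text \<open>
  The operators \<open>L(t)\<close> are only strongly continuous in \<open>t\<close>; their uniform bound \<open>M\<close> absorbs the
  simultaneous variation of the segment.
\<close>

lemma continuous_on_L_seg:
  assumes x: "continuous_on UNIV x"
  shows "continuous_on UNIV (\<lambda>t. L t (seg r x t))"
  unfolding continuous_on_def
proof
  fix t :: real
  have "((\<lambda>s. seg r x s) \<longlongrightarrow> seg r x t) (at t)"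
    using continuous_on_seg[OF r_pos x] by (simp add: continuous_on_def)
  then have "((\<lambda>s. M * norm (seg r x s - seg r x t)) \<longlongrightarrow> M * norm (seg r x t - seg r x t)) (at t)"
    by (intro tendsto_intros)
  then have lim: "((\<lambda>s. M * norm (seg r x s - seg r x t)) \<longlongrightarrow> 0) (at t)"
    by simp
  have "norm (L s (seg r x s) - L s (seg r x t)) \<le> M * norm (seg r x s - seg r x t)" for s
    using L_le[OF Cspace_diff] L_diff segI[OF x] by metis
  then have "((\<lambda>s. L s (seg r x s) - L s (seg r x t)) \<longlongrightarrow> 0) (at t)"
    by (intro Lim_null_comparison[OF always_eventually lim] allI)
  moreover have "((\<lambda>s. L s (seg r x t)) \<longlongrightarrow> L t (seg r x t)) (at t)"
    using L_cont[OF segI[OF x]] by (simp add: continuous_on_def)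
  ultimately have "((\<lambda>s. (L s (seg r x s) - L s (seg r x t)) + L s (seg r x t))
      \<longlongrightarrow> 0 + L t (seg r x t)) (at t)"
    by (rule tendsto_add)
  then show "((\<lambda>t. L t (seg r x t)) \<longlongrightarrow> L t (seg r x t)) (at t within UNIV)" by simp
qed

lemma continuous_on_F_seg:
  assumes x: "continuous_on UNIV x"
  shows "continuous_on UNIV (\<lambda>t. F t (seg r x t))"
proof -
  have "continuous_on UNIV (\<lambda>t. (t, seg r x t))"
    by (intro continuous_intros continuous_on_seg r_pos x)
  from continuous_on_compose2[OF F_cont this] show ?thesis
    using x by (simp add: image_subset_iff)
qed

lemma norm_seg_diff_le:
  assumes lag: "\<And>s. t - r \<le> s \<Longrightarrow> s \<le> t \<Longrightarrow> w s \<le> exp (lam * r) * w t"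
    and x: "continuous_on UNIV x" and y: "continuous_on UNIV y" and B: "0 \<le> B"
    and le: "\<And>s. s \<le> t \<Longrightarrow> norm (x s - y s) \<le> B * w s"
  shows "norm (seg r x t - seg r y t) \<le> B * exp (lam * r) * w t"
proof -
  have "norm (seg r (\<lambda>s. x s - y s) t) \<le> B * exp (lam * r) * w t"
  proof (rule norm_seg_le[OF r_pos])
    show "continuous_on {t - r..t} (\<lambda>s. x s - y s)"
      using x y by (auto intro!: continuous_intros intro: continuous_on_subset)
    show "norm (x s - y s) \<le> B * exp (lam * r) * w t" if "t - r \<le> s" "s \<le> t" for s
      using le[OF that(2)] mult_left_mono[OF lag[OF that] B] by (simp add: mult.assoc)
  qed
  then show ?thesis using x y by (simp add: seg_diff)
qed

lemma norm_L_seg_diff_le: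
  assumes "continuous_on UNIV x" and "continuous_on UNIV y"
    and "norm (seg r x t - seg r y t) \<le> N"
  shows "norm (L t (seg r x t) - L t (seg r y t)) \<le> M * N"
proof -
  have "norm (L t (seg r x t) - L t (seg r y t)) \<le> M * norm (seg r x t - seg r y t)"
    using L_le[OF Cspace_diff] L_diff segI[OF assms(1)] segI[OF assms(2)] by metis
  also have "\<dots> \<le> M * N" using assms(3) M_nonneg by (rule mult_left_mono)
  finally show ?thesis .
qed

lemma norm_F_seg_diff_le:
  assumes "continuous_on UNIV x" and "continuous_on UNIV y"
    and "norm (seg r x t - seg r y t) \<le> N"
  shows "norm (F t (seg r x t) - F t (seg r y t)) \<le> K * N"
proof -
  have "norm (F t (seg r x t) - F t (seg r y t)) \<le> K * norm (seg r x t - seg r y t)"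
    using assms by (intro F_lip) auto
  also have "\<dots> \<le> K * N" using assms(3) K_nonneg by (rule mult_left_mono)
  finally show ?thesis .
qed

definition contraction_factor :: real ("q") where
  "q = exp (lam * r) * (M + K / lam)"

lemma q_nonneg: "0 \<le> q" and q_less_1: "q < 1"
  using gap lam_pos M_nonneg K_nonneg by (auto simp: contraction_factor_def)

text \<open>
  If the difference of two functions is bounded by \<open>B w\<close>, then feeding this bound through \<open>L\<close>, \<open>F\<close> and the
  integral, which is what \<open>gain\<close> stands for, improves it to \<open>q B w\<close>, hence to \<open>q\<^sup>n B w\<close> for all \<open>n\<close>. The
  estimate at time \<open>t\<close> uses the segments that end at \<open>t\<close>, so it may be confined to a set \<open>S\<close> of times that is
  closed to the left. Half lines \<open>S\<close> serve for functions without a bound in the future.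
\<close>

lemma weighted_difference_vanishes:
  assumes w_nonneg: "\<And>t. 0 \<le> w t"
    and lag: "\<And>s t. t - r \<le> s \<Longrightarrow> s \<le> t \<Longrightarrow> w s \<le> exp (lam * r) * w t"
    and down: "\<And>s t. t \<in> S \<Longrightarrow> s \<le> t \<Longrightarrow> s \<in> S"
    and x: "continuous_on UNIV x" and y: "continuous_on UNIV y"
    and bounded: "\<And>t. t \<in> S \<Longrightarrow> norm (x t - y t) \<le> B * w t"
    and gain: "\<And>C t. (\<And>s. s \<in> S \<Longrightarrow> norm (F s (seg r x s) - F s (seg r y s)) \<le> C * w s) \<Longrightarrow>
      t \<in> S \<Longrightarrow>
      norm ((x t - L t (seg r x t)) - (y t - L t (seg r y t))) \<le> C / lam * w t"
    and t: "t \<in> S"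
  shows "x t = y t"
proof -
  have iter: "norm (x t - y t) \<le> q ^ n * \<bar>B\<bar> * w t" if "t \<in> S" for n t
    using that
  proof (induction n arbitrary: t)
    case 0
    have "B * w t \<le> \<bar>B\<bar> * w t" using w_nonneg by (intro mult_right_mono) auto
    then show ?case using bounded[OF 0] by simp
  next
    case (Suc n)
    define B' where "B' = q ^ n * \<bar>B\<bar>"
    have B': "0 \<le> B'" using q_nonneg by (simp add: B'_def)
    have seg_le: "norm (seg r x s - seg r y s) \<le> B' * exp (lam * r) * w s" if "s \<in> S" for s
      using Suc.IH down[OF that] by (intro norm_seg_diff_le lag x y B') (auto simp: B'_def)
    have "norm (F s (seg r x s) - F s (seg r y s)) \<le> K * (B' * exp (lam * r)) * w s"
      if "s \<in> S" for s
      using norm_F_seg_diff_le[OF x y seg_le[OF that]] by (simp add: mult.assoc)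
    from gain[OF this Suc.prems]
    have 1: "norm ((x t - L t (seg r x t)) - (y t - L t (seg r y t)))
        \<le> K * (B' * exp (lam * r)) / lam * w t" .
    have 2: "norm (L t (seg r x t) - L t (seg r y t)) \<le> M * (B' * exp (lam * r) * w t)"
      by (rule norm_L_seg_diff_le[OF x y seg_le[OF Suc.prems]])
    have "x t - y t = ((x t - L t (seg r x t)) - (y t - L t (seg r y t)))
        + (L t (seg r x t) - L t (seg r y t))" by simp
    then have "norm (x t - y t)
        \<le> K * (B' * exp (lam * r)) / lam * w t + M * (B' * exp (lam * r) * w t)"
      using norm_triangle_le[OF add_mono[OF 1 2]] by metis
    also have "\<dots> = q * B' * w t"
      by (simp add: contraction_factor_def algebra_simps)
    finally show ?case by (simp add: B'_def mult.assoc)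
  qed
  have "(\<lambda>n. q ^ n * \<bar>B\<bar> * w t) \<longlonglongrightarrow> 0 * \<bar>B\<bar> * w t"
    using q_nonneg q_less_1 by (intro tendsto_intros LIMSEQ_realpow_zero)
  then have "norm (x t - y t) \<le> 0 * \<bar>B\<bar> * w t"
    using iter[OF t] by (intro LIMSEQ_le_const) auto
  then show ?thesis by simp
qed

text \<open>
  Banach's fixed point theorem for perturbations \<open>z\<close> of a given function \<open>X\<close>, in the norm
  \<open>sup |z| / w\<close>. The filter \<open>A\<close> is the place at which the primitive \<open>p\<close> is normalised to vanish: \<open>at 0\<close> for an
  initial value problem, and \<open>at_top\<close> when the difference of the solutions has to decay.
\<close>

lemma weighted_perturbation_exists:
  fixes w :: "real \<Rightarrow> real" and A :: "real filter" and X c :: "real \<Rightarrow> 'a"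
  assumes w_pos: "\<And>t. 0 < w t" and w_cont: "continuous_on UNIV w"
    and lag: "\<And>s t. t - r \<le> s \<Longrightarrow> s \<le> t \<Longrightarrow> w s \<le> exp (lam * r) * w t"
    and prim: "\<And>(f :: real \<Rightarrow> 'a) C. continuous_on UNIV f \<Longrightarrow> (\<And>t. norm (f t) \<le> C * w t) \<Longrightarrow>
      \<exists>g. (g \<longlongrightarrow> 0) A \<and> (\<forall>t. (g has_vector_derivative f t) (at t))"
    and gain: "\<And>(f :: real \<Rightarrow> 'a) g C t. (\<And>t. (g has_vector_derivative f t) (at t)) \<Longrightarrow>
      (g \<longlongrightarrow> 0) A \<Longrightarrow> (\<And>t. norm (f t) \<le> C * w t) \<Longrightarrow> norm (g t) \<le> C / lam * w t"
    and X: "continuous_on UNIV X" and c: "continuous_on UNIV c"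
    and c_le: "\<And>t. norm (c t) \<le> B * w t"
  obtains z p B' where "continuous_on UNIV z" and "\<And>t. norm (z t) \<le> B' * w t"
    and "(p \<longlongrightarrow> 0) A"
    and "\<And>t. (p has_vector_derivative
          F t (seg r (\<lambda>s. X s + z s) t) - F t (seg r X t)) (at t)"
    and "\<And>t. z t - (L t (seg r (\<lambda>s. X s + z s) t) - L t (seg r X t)) = c t + p t"
proof -
  \<comment> \<open>The weighted space is modelled on bounded continuous functions through \<open>z = w u\<close>.\<close>
  define Y where "Y u s = X s + w s *\<^sub>R apply_bcontfun u s" for u :: "real \<Rightarrow>\<^sub>C 'a" and s
  define f where "f u t = F t (seg r (Y u) t) - F t (seg r X t)" for u t
  define l where "l u t = L t (seg r (Y u) t) - L t (seg r X t)" for u t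
  have Y: "continuous_on UNIV (Y u)" for u
    unfolding Y_def by (intro continuous_intros X w_cont) simp
  have Y0: "Y 0 = X" by (simp add: Y_def fun_eq_iff)
  have Y_le: "norm (Y u s - Y v s) \<le> dist u v * w s" for u v s
  proof -
    have "Y u s - Y v s = w s *\<^sub>R (apply_bcontfun u s - apply_bcontfun v s)"
      by (simp add: Y_def scaleR_diff_right)
    then have "norm (Y u s - Y v s) = w s * dist (apply_bcontfun u s) (apply_bcontfun v s)"
      using w_pos[of s] by (simp add: dist_norm)
    also have "\<dots> \<le> w s * dist u v"
      using w_pos[of s] by (intro mult_left_mono dist_bounded) simp
    finally show ?thesis by (simp add: mult.commute)
  qed
  have seg_le: "norm (seg r (Y u) t - seg r (Y v) t) \<le> dist u v * exp (lam * r) * w t" for u v t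
    by (intro norm_seg_diff_le lag Y Y_le) auto
  have f: "continuous_on UNIV (f u)" for u
    unfolding f_def by (intro continuous_intros continuous_on_F_seg Y X)
  have f_diff: "norm (f u t - f v t) \<le> K * (dist u v * exp (lam * r)) * w t" for u v t
    using norm_F_seg_diff_le[OF Y Y seg_le] by (simp add: f_def mult.assoc)
  have f_le: "norm (f u t) \<le> K * (dist u 0 * exp (lam * r)) * w t" for u t
    using f_diff[of u t 0] by (simp add: f_def Y0)
  \<comment> \<open>One normalised primitive is chosen for each \<open>u\<close>; \<open>gain\<close>, applied to differences, makes the choice Lipschitz in \<open>u\<close>.\<close>
  have "\<forall>u. \<exists>g. (g \<longlongrightarrow> 0) A \<and> (\<forall>t. (g has_vector_derivative f u t) (at t))"
    using prim[OF f f_le] by blast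
  then obtain p where p0: "\<And>u. (p u \<longlongrightarrow> 0) A"
    and p': "\<And>u t. (p u has_vector_derivative f u t) (at t)"
    by metis
  have p: "continuous_on UNIV (p u)" for u
    using p' by (meson continuous_at_imp_continuous_on has_vector_derivative_continuous)
  have p_le: "norm (p u t) \<le> K * (dist u 0 * exp (lam * r)) / lam * w t" for u t
    by (rule gain[OF p' p0 f_le])
  have p_diff: "norm (p u t - p v t) \<le> K * (dist u v * exp (lam * r)) / lam * w t" for u v t
  proof (rule gain[where f = "\<lambda>t. f u t - f v t" and g = "\<lambda>t. p u t - p v t"])
    show "((\<lambda>t. p u t - p v t) \<longlongrightarrow> 0) A"
      using tendsto_diff[OF p0 p0] by simp
  qed (auto intro!: derivative_eq_intros p' f_diff)
  have l: "continuous_on UNIV (l u)" for u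
    unfolding l_def by (intro continuous_intros continuous_on_L_seg Y X)
  have l_diff: "norm (l u t - l v t) \<le> M * (dist u v * exp (lam * r)) * w t" for u v t
    using norm_L_seg_diff_le[OF Y Y seg_le] by (simp add: l_def mult.assoc)
  have l_le: "norm (l u t) \<le> M * (dist u 0 * exp (lam * r)) * w t" for u t
    using l_diff[of u t 0] by (simp add: l_def Y0)
  \<comment> \<open>The right-hand side of the integrated equation, rescaled: its fixed points \<open>u\<close> give the solutions \<open>z = w u\<close>.\<close>
  define a where "a u t = (1 / w t) *\<^sub>R (l u t + c t + p u t)" for u t
  have a_bc: "a u \<in> bcontfun" for u
  proof (rule bcontfun_normI)
    show "continuous_on UNIV (a u)"
      unfolding a_def using w_pos by (intro continuous_intros w_cont l c p) (metis less_irrefl)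
    fix t
    have "norm (l u t + c t + p u t) \<le> M * (dist u 0 * exp (lam * r)) * w t + B * w t
        + K * (dist u 0 * exp (lam * r)) / lam * w t"
      by (intro norm_triangle_le add_mono l_le c_le p_le)
    also have "\<dots> = (q * dist u 0 + B) * w t"
      by (simp add: contraction_factor_def algebra_simps)
    finally have "norm (l u t + c t + p u t) / w t \<le> q * dist u 0 + B"
      using w_pos[of t] by (simp only: pos_divide_le_eq)
    moreover have "norm (a u t) = norm (l u t + c t + p u t) / w t"
      using w_pos[of t] unfolding a_def norm_scaleR by simp
    ultimately show "norm (a u t) \<le> q * dist u 0 + B" by simp
  qed
  have "\<exists>!u. Bcontfun (a u) = u"
  proof (rule banach_fix_type[OF q_nonneg q_less_1], intro allI)
    fix u v
    show "dist (Bcontfun (a u)) (Bcontfun (a v)) \<le> q * dist u v"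
    proof (rule dist_bound)
      fix t
      have "norm ((l u t - l v t) + (p u t - p v t)) \<le> M * (dist u v * exp (lam * r)) * w t
          + K * (dist u v * exp (lam * r)) / lam * w t"
        by (intro norm_triangle_le add_mono l_diff p_diff)
      also have "\<dots> = q * dist u v * w t"
        by (simp add: contraction_factor_def algebra_simps)
      finally have le: "norm ((l u t - l v t) + (p u t - p v t)) \<le> q * dist u v * w t" .
      have "a u t - a v t = (1 / w t) *\<^sub>R ((l u t - l v t) + (p u t - p v t))"
        by (simp add: a_def algebra_simps)
      then have "norm (a u t - a v t) = norm ((l u t - l v t) + (p u t - p v t)) / w t"
        using w_pos[of t] by (simp only: norm_scaleR) simp
      also have "\<dots> \<le> q * dist u v"
        using le w_pos[of t] by (simp only: pos_divide_le_eq)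
      finally have "norm (a u t - a v t) \<le> q * dist u v" .
      then show "dist (apply_bcontfun (Bcontfun (a u)) t) (apply_bcontfun (Bcontfun (a v)) t)
          \<le> q * dist u v"
        by (simp add: Bcontfun_inverse[OF a_bc] dist_norm)
    qed
  qed
  then obtain u where "Bcontfun (a u) = u" by blast
  then have u: "apply_bcontfun u = a u" using Bcontfun_inverse[OF a_bc, of u] by simp
  define z where "z t = w t *\<^sub>R apply_bcontfun u t" for t
  have Yu: "Y u = (\<lambda>s. X s + z s)" by (auto simp: Y_def z_def)
  show thesis
  proof (rule that)
    show "continuous_on UNIV z"
      unfolding z_def by (intro continuous_intros w_cont) simp
    show "norm (z t) \<le> norm u * w t" for t
      using Y_le[of u t 0] by (simp add: Y_def z_def)
    show "(p u \<longlongrightarrow> 0) A" by (rule p0)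
    show "(p u has_vector_derivative
          F t (seg r (\<lambda>s. X s + z s) t) - F t (seg r X t)) (at t)" for t
      using p'[of u t] by (simp add: f_def Yu)
    show "z t - (L t (seg r (\<lambda>s. X s + z s) t) - L t (seg r X t)) = c t + p u t" for t
    proof -
      have "z t = l u t + c t + p u t"
        using w_pos[of t] by (simp add: z_def u a_def)
      then show ?thesis by (simp add: l_def Yu)
    qed
  qed
qed

section \<open>Solutions on the line\<close>

lemma abs_weight_lag:
  assumes "t - r \<le> s" "s \<le> t"
  shows "exp (lam * \<bar>s\<bar>) \<le> exp (lam * r) * exp (lam * \<bar>t\<bar>)"
proof -
  have "lam * \<bar>s\<bar> \<le> lam * (r + \<bar>t\<bar>)" using assms lam_pos r_pos by (intro mult_left_mono) auto
  then show ?thesis by (simp add: exp_add[symmetric] algebra_simps)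
qed

lemma decay_weight_lag:
  assumes "t - r \<le> s" "s \<le> t"
  shows "exp (- lam * s) \<le> exp (lam * r) * exp (- lam * t)"
proof -
  have "lam * (t - r) \<le> lam * s" using assms lam_pos by (intro mult_left_mono) auto
  then show ?thesis by (simp add: exp_add[symmetric] algebra_simps)
qed

lemma solution_on_lineD:
  assumes "solution_on_line r L F y"
  shows "continuous_on UNIV y"
    and "((\<lambda>s. y s - L s (seg r y s)) has_vector_derivative F t (seg r y t)) (at t)"
  using assms by (auto simp: solution_on_line_def satisfies_eq_on_def)

lemma solution_on_lineI:
  assumes "continuous_on UNIV y"
    and "\<And>t. ((\<lambda>s. y s - L s (seg r y s)) has_vector_derivative F t (seg r y t)) (at t)"
  shows "solution_on_line r L F y"
  using assms continuous_on_F_seg by (auto simp: solution_on_line_def satisfies_eq_on_def)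

lemma weight_boundD:
  fixes y :: "real \<Rightarrow> 'b::real_normed_vector"
  assumes "bdd_above ((\<lambda>t. norm (y t) * exp (lam * t)) ` T)"
  obtains B where "0 \<le> B" and "\<And>t. t \<in> T \<Longrightarrow> norm (y t) \<le> B * exp (- lam * t)"
proof -
  obtain B where B: "\<And>t. t \<in> T \<Longrightarrow> norm (y t) * exp (lam * t) \<le> B"
    using assms by (auto simp: bdd_above_def)
  have "norm (y t) \<le> \<bar>B\<bar> * exp (- lam * t)" if "t \<in> T" for t
  proof -
    have "norm (y t) = norm (y t) * exp (lam * t) * exp (- lam * t)"
      by (simp add: exp_minus)
    also have "\<dots> \<le> \<bar>B\<bar> * exp (- lam * t)"
      using B[OF that] by (intro mult_right_mono) auto
    finally show ?thesis .
  qed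
  then show thesis using that[of "\<bar>B\<bar>"] by auto
qed

lemma weight_boundI:
  fixes y :: "real \<Rightarrow> 'b::real_normed_vector"
  assumes "\<And>t. t \<in> T \<Longrightarrow> norm (y t) \<le> B * exp (- lam * t)"
  shows "bdd_above ((\<lambda>t. norm (y t) * exp (lam * t)) ` T)"
proof (rule bdd_aboveI2)
  fix t assume "t \<in> T"
  then have "norm (y t) * exp (lam * t) \<le> B * exp (- lam * t) * exp (lam * t)"
    by (intro mult_right_mono assms) auto
  also have "\<dots> = B" by (simp add: exp_minus)
  finally show "norm (y t) * exp (lam * t) \<le> B" .
qed

text \<open>
  Nothing is assumed about growth in the future, so the uniqueness estimate is applied on
  \<open>(-\<infinity>,T]\<close> for each \<open>T \<ge> 0\<close> separately: on \<open>[0,T]\<close> the difference is bounded by compactness.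
\<close>

lemma line_solution_unique:
  assumes x: "solution_on_line r L F x" and y: "solution_on_line r L F y"
    and eq0: "x 0 - L 0 (seg r x 0) = y 0 - L 0 (seg r y 0)"
    and bdx: "bdd_above ((\<lambda>t. norm (x t) * exp (lam * t)) ` {..0})"
    and bdy: "bdd_above ((\<lambda>t. norm (y t) * exp (lam * t)) ` {..0})"
  shows "x = y"
proof
  fix t :: real
  define T where "T = max t 0"
  note cx = solution_on_lineD(1)[OF x] and cy = solution_on_lineD(1)[OF y]
  obtain Bx where Bx: "0 \<le> Bx" "\<And>t. t \<in> {..0} \<Longrightarrow> norm (x t) \<le> Bx * exp (- lam * t)"
    by (rule weight_boundD[OF bdx]) blast
  obtain By where By: "0 \<le> By" "\<And>t. t \<in> {..0} \<Longrightarrow> norm (y t) \<le> By * exp (- lam * t)"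
    by (rule weight_boundD[OF bdy]) blast
  have "compact ((\<lambda>s. x s - y s) ` {0..T})"
    using cx cy by (intro compact_continuous_image) (auto intro!: continuous_intros intro: continuous_on_subset)
  then obtain B where B: "0 < B" "\<And>s. s \<in> {0..T} \<Longrightarrow> norm (x s - y s) \<le> B"
    by (force dest!: compact_imp_bounded simp: bounded_pos)
  have bound: "norm (x s - y s) \<le> (Bx + By + B) * exp (lam * \<bar>s\<bar>)" if "s \<le> T" for s
  proof (cases "s \<le> 0")
    case True
    have "norm (x s - y s) \<le> Bx * exp (- lam * s) + By * exp (- lam * s)"
      using True by (intro norm_triangle_le_diff add_mono Bx By) auto
    also have "\<dots> = (Bx + By) * exp (lam * \<bar>s\<bar>)" using True by (simp add: algebra_simps)
    also have "\<dots> \<le> (Bx + By + B) * exp (lam * \<bar>s\<bar>)"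
      using B(1) by (intro mult_right_mono) auto
    finally show ?thesis .
  next
    case False
    then have "norm (x s - y s) \<le> B * 1" using B(2)[of s] that by simp
    also have "\<dots> \<le> (Bx + By + B) * exp (lam * \<bar>s\<bar>)"
      using Bx By B lam_pos by (intro mult_mono) auto
    finally show ?thesis .
  qed
  show "x t = y t"
  proof (rule weighted_difference_vanishes[where S = "{..T}" and w = "\<lambda>s. exp (lam * \<bar>s\<bar>)",
        OF _ abs_weight_lag _ cx cy bound])
    fix C s
    assume F_le: "\<And>u. u \<in> {..T} \<Longrightarrow> norm (F u (seg r x u) - F u (seg r y u)) \<le> C * exp (lam * \<bar>u\<bar>)"
      and s: "s \<in> {..T}"
    show "norm ((x s - L s (seg r x s)) - (y s - L s (seg r y s))) \<le> C / lam * exp (lam * \<bar>s\<bar>)"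
    proof (rule primitive_at_0_le[OF lam_pos,
          where f = "\<lambda>u. F u (seg r x u) - F u (seg r y u)"])
      show "norm (F u (seg r x u) - F u (seg r y u)) \<le> C * exp (lam * \<bar>u\<bar>)"
        if "u \<in> closed_segment 0 s" for u
        using that s by (intro F_le) (auto simp: closed_segment_eq_real_ivl T_def split: if_splits)
    qed (use eq0 in \<open>auto intro!: has_vector_derivative_diff[OF
        solution_on_lineD(2)[OF x] solution_on_lineD(2)[OF y]]\<close>)
  qed (auto simp: T_def)
qed

text \<open>
  Perturbing the zero function with \<open>c(t) = \<xi> + \<integral>\<^sub>0\<^sup>t F(s,0) ds\<close>, which grows at most like
  \<open>exp (\<lambda> |t|)\<close>, and with primitives that vanish at \<open>0\<close>, turns the fixed point equation into the
  integrated Cauchy problem.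
\<close>

lemma line_solution_exists:
  obtains y where "solution_on_line r L F y" and "y 0 - L 0 (seg r y 0) = \<xi>"
    and "bdd_above ((\<lambda>t. norm (y t) * exp (lam * t)) ` {..0})"
proof -
  have F0: "continuous_on UNIV (\<lambda>t. F t 0)"
    using continuous_on_F_seg[of "\<lambda>_. 0"] by simp
  obtain g where g0: "g 0 = 0" and g: "\<And>t. (g has_vector_derivative F t 0) (at t)"
    by (rule primitive_exists[OF F0]) blast
  have g_le: "norm (g t) \<le> M0 / lam * exp (lam * \<bar>t\<bar>)" for t
    by (rule primitive_at_0_le[OF lam_pos g g0 F_zero_le])
  obtain y p B' where y: "continuous_on UNIV y" and y_le: "\<And>t. norm (y t) \<le> B' * exp (lam * \<bar>t\<bar>)"
    and p0: "(p \<longlongrightarrow> 0) (at 0)"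
    and p: "\<And>t. (p has_vector_derivative F t (seg r (\<lambda>s. 0 + y s) t) - F t (seg r (\<lambda>_. 0) t)) (at t)"
    and yp: "\<And>t. y t - (L t (seg r (\<lambda>s. 0 + y s) t) - L t (seg r (\<lambda>_. 0) t)) = (\<xi> + g t) + p t"
  proof (rule weighted_perturbation_exists[where w = "\<lambda>t. exp (lam * \<bar>t\<bar>)" and A = "at 0"
        and X = "\<lambda>_. 0" and c = "\<lambda>t. \<xi> + g t" and B = "norm \<xi> + M0 / lam", OF _ _ abs_weight_lag])
    fix f :: "real \<Rightarrow> 'a" assume "continuous_on UNIV f"
    then obtain h where "h 0 = 0" "\<And>t. (h has_vector_derivative f t) (at t)"
      by (rule primitive_exists) blast
    then show "\<exists>h. (h \<longlongrightarrow> 0) (at 0) \<and> (\<forall>t. (h has_vector_derivative f t) (at t))"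
      using has_vector_derivative_continuous continuous_at by metis
  next
    fix f h :: "real \<Rightarrow> 'a" and C t
    assume h: "\<And>t. (h has_vector_derivative f t) (at t)" and h0: "(h \<longlongrightarrow> 0) (at 0)"
      and f: "\<And>t. norm (f t) \<le> C * exp (lam * \<bar>t\<bar>)"
    have "(h \<longlongrightarrow> h 0) (at 0)"
      using has_vector_derivative_continuous[OF h] by (simp add: continuous_at)
    then have "h 0 = 0" using h0 by (rule tendsto_unique[OF at_neq_bot])
    then show "norm (h t) \<le> C / lam * exp (lam * \<bar>t\<bar>)"
      by (rule primitive_at_0_le[OF lam_pos h _ f])
  next
    show "continuous_on UNIV (\<lambda>t. \<xi> + g t)"
      using g by (intro continuous_intros)
        (meson continuous_at_imp_continuous_on has_vector_derivative_continuous)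
    fix t
    have "norm \<xi> * 1 \<le> norm \<xi> * exp (lam * \<bar>t\<bar>)" using lam_pos by (intro mult_left_mono) auto
    then show "norm (\<xi> + g t) \<le> (norm \<xi> + M0 / lam) * exp (lam * \<bar>t\<bar>)"
      using g_le[of t] by (intro norm_triangle_le) (simp add: algebra_simps)
  qed (auto intro!: continuous_intros)
  have L0: "L t 0 = 0" for t using L_le[of 0 t] segI[of "\<lambda>_. 0"] by simp
  have yp: "y t - L t (seg r y t) = \<xi> + g t + p t" for t using yp[of t] by (simp add: L0)
  show thesis
  proof (rule that[of y])
    show "solution_on_line r L F y"
    proof (rule solution_on_lineI[OF y])
      fix t
      show "((\<lambda>s. y s - L s (seg r y s)) has_vector_derivative F t (seg r y t)) (at t)"
        unfolding yp using p[of t] by (auto intro!: derivative_eq_intros g)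
    qed
    have "(p \<longlongrightarrow> p 0) (at 0)"
      using has_vector_derivative_continuous[OF p] by (simp add: continuous_at)
    then have "p 0 = 0" using p0 by (rule tendsto_unique[OF at_neq_bot])
    then show "y 0 - L 0 (seg r y 0) = \<xi>" by (simp add: yp g0)
    show "bdd_above ((\<lambda>t. norm (y t) * exp (lam * t)) ` {..0})"
      using y_le by (intro weight_boundI[where B = B']) (metis abs_of_nonpos atMost_iff mult_minus_left mult_minus_right)
  qed
qed

lemma Psi_eqI:
  assumes "solution_on_line r L F y"
    and "bdd_above ((\<lambda>t. norm (y t) * exp (lam * t)) ` {..0})"
  shows "Psi r lam L F t (y 0 - L 0 (seg r y 0)) = y t"
proof -
  have "(THE x. solution_on_line r L F x \<and> x 0 - L 0 (seg r x 0) = y 0 - L 0 (seg r y 0) \<and>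
      bdd_above ((\<lambda>t. norm (x t) * exp (lam * t)) ` {..0})) = y"
    by (intro the_equality conjI assms refl)
      (elim conjE, rule line_solution_unique[OF _ assms(1) _ _ assms(2)])
  then show ?thesis by (simp add: Psi_def)
qed

section \<open>Asymptotic coincidence\<close>

text \<open>
  The bound on \<open>x - y\<close> passes to its segments, so \<open>(x - y)(t) - L(t)(x - y)\<^sub>t\<close> tends to \<open>0\<close> at
  \<open>+\<infinity>\<close>. It is therefore the primitive normalised at \<open>+\<infinity>\<close> of the difference of the right-hand sides.
\<close>

lemma decaying_difference_vanishes:
  assumes x: "solution_on_line r L F x" and y: "solution_on_line r L F y"
    and bound: "\<And>t. norm (x t - y t) \<le> B * exp (- lam * t)" and B: "0 \<le> B"
  shows "x = y"
proof
  fix t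
  note cx = solution_on_lineD(1)[OF x] and cy = solution_on_lineD(1)[OF y]
  let ?g = "\<lambda>s. (x s - L s (seg r x s)) - (y s - L s (seg r y s))"
  have "norm (?g s) \<le> (B + M * (B * exp (lam * r))) * exp (- lam * s)" for s
  proof -
    have "norm (seg r x s - seg r y s) \<le> B * exp (lam * r) * exp (- lam * s)"
      by (rule norm_seg_diff_le[OF decay_weight_lag cx cy B bound])
    note L_le = norm_L_seg_diff_le[OF cx cy this]
    have "norm ((x s - y s) - (L s (seg r x s) - L s (seg r y s)))
        \<le> B * exp (- lam * s) + M * (B * exp (lam * r) * exp (- lam * s))"
      by (rule norm_triangle_le_diff[OF add_mono[OF bound L_le]])
    then show ?thesis by (simp add: algebra_simps)
  qed
  then have lim: "(?g \<longlongrightarrow> 0) at_top"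
    by (intro Lim_null_comparison[OF _ tendsto_exp_decay_at_top[OF lam_pos]] always_eventually allI)
  show "x t = y t"
  proof (rule weighted_difference_vanishes[where S = UNIV and w = "\<lambda>s. exp (- lam * s)",
        OF _ decay_weight_lag _ cx cy bound])
    fix C s
    assume "\<And>u. u \<in> UNIV \<Longrightarrow> norm (F u (seg r x u) - F u (seg r y u)) \<le> C * exp (- lam * u)"
    then show "norm (?g s) \<le> C / lam * exp (- lam * s)"
      by (intro primitive_at_top_le[OF lam_pos _ lim,
            where f = "\<lambda>u. F u (seg r x u) - F u (seg r y u)"])
        (auto intro!: has_vector_derivative_diff[OF
          solution_on_lineD(2)[OF x] solution_on_lineD(2)[OF y]])
  qed auto
qed

text \<open>
  Extend \<open>x\<close> to the left by a constant and call the result \<open>X\<close>. The function \<open>c\<close> below is the defect of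
  \<open>X\<close> in the integrated equation. It vanishes for \<open>t \<ge> 0\<close>, where \<open>X\<close> is a solution, and for \<open>t \<le> 0\<close> it is at most a
  multiple of \<open>exp (- \<lambda> t)\<close>, as \<open>X\<close> is bounded there; so it is admissible for the decaying weight.
  With \<open>z(t) = L(t)z\<^sub>t + c(t) + p(t)\<close> the defect cancels: \<open>y = X + z\<close> satisfies
  \<open>y(t) - L(t)y\<^sub>t = a + g(t) + p(t)\<close>, whose derivative is \<open>F(t,X\<^sub>t) + (F(t,y\<^sub>t) - F(t,X\<^sub>t))\<close>.
\<close>

lemma shadowing_line_solution_exists:
  assumes x: "solution_from r L F \<phi> x"
  obtains y B where "solution_on_line r L F y"
    and "bdd_above ((\<lambda>t. norm (y t) * exp (lam * t)) ` {..0})"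
    and "\<And>t. 0 \<le> t \<Longrightarrow> norm (x t - y t) \<le> B * exp (- lam * t)"
proof -
  define X where "X t = x (max t (- r))" for t
  have X: "continuous_on UNIV X"
  proof -
    have "continuous_on {- r..} x" using x by (simp add: solution_from_def)
    then show ?thesis
      unfolding X_def by (rule continuous_on_compose2) (auto intro!: continuous_intros)
  qed
  have segX: "seg r X t = seg r x t" if "0 \<le> t" for t
    using that by (intro seg_cong r_pos) (auto simp: X_def)
  have Xx: "X t = x t" if "0 \<le> t" for t using that r_pos by (simp add: X_def)
  obtain N where N: "0 \<le> N" "\<And>s. s \<le> 0 \<Longrightarrow> norm (X s) \<le> N"
  proof -
    have "compact (X ` {- r..0})"
      using X by (intro compact_continuous_image) (auto intro: continuous_on_subset)
    then obtain N where N: "0 < N" "\<And>s. s \<in> {- r..0} \<Longrightarrow> norm (X s) \<le> N"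
      by (force dest!: compact_imp_bounded simp: bounded_pos)
    have "norm (X s) \<le> N" if "s \<le> 0" for s
      using N(2)[of "max s (- r)"] that r_pos by (simp add: X_def)
    then show thesis using N(1) by (intro that[of N]) auto
  qed
  define a where "a = X 0 - L 0 (seg r X 0)"
  obtain g where g0: "g 0 = 0" and g: "\<And>t. (g has_vector_derivative F t (seg r X t)) (at t)"
    by (rule primitive_exists[OF continuous_on_F_seg[OF X]]) blast
  have gc: "continuous_on UNIV g"
    using g by (meson continuous_at_imp_continuous_on has_vector_derivative_continuous)
  define c where "c t = a + g t - (X t - L t (seg r X t))" for t
  have c: "continuous_on UNIV c"
    unfolding c_def by (intro continuous_intros gc X continuous_on_L_seg)
  have c_pos: "c t = 0" if "0 \<le> t" for t
  proof -
    have "(c has_vector_derivative 0) (at s within {0..})" if "s \<in> {0..}" for s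
    proof -
      have "((\<lambda>s. x s - L s (seg r x s)) has_vector_derivative F s (seg r x s)) (at s within {0..})"
        using x that by (auto simp: solution_from_def satisfies_eq_on_def)
      then have "((\<lambda>s. X s - L s (seg r X s)) has_vector_derivative F s (seg r X s))
          (at s within {0..})"
        by (subst segX, use that in simp)
          (rule has_vector_derivative_transform[rotated 2], use that in \<open>simp_all add: segX Xx\<close>)
      moreover have "((\<lambda>s. a + g s) has_vector_derivative F s (seg r X s)) (at s within {0..})"
        by (auto intro!: derivative_eq_intros has_vector_derivative_at_within[OF g])
      ultimately show ?thesis
        using has_vector_derivative_diff unfolding c_def by fastforce
    qed
    then obtain k where "\<And>s. s \<in> {0..} \<Longrightarrow> c s = k"
      using has_vector_derivative_zero_constant[OF convex_real_interval(1)] by blast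
    from this[of t] this[of 0] show ?thesis using that by (simp add: c_def a_def g0)
  qed
  have segX_le: "norm (seg r X s) \<le> N" if "s \<le> 0" for s
    using X N that by (intro norm_seg_le r_pos) (auto intro: continuous_on_subset)
  have F_le: "norm (F s (seg r X s)) \<le> (M0 + K * N) * exp (lam * \<bar>s\<bar>)" if "s \<le> 0" for s
  proof -
    have "norm (F s (seg r X s) - F s (seg r (\<lambda>_. 0) s)) \<le> K * N"
      using segX_le[OF that] by (intro norm_F_seg_diff_le X) auto
    then have "norm (F s (seg r X s)) \<le> K * N + norm (F s 0)"
      using norm_triangle_sub[of "F s (seg r X s)" "F s 0"] by simp
    also have "\<dots> \<le> K * N * exp (lam * \<bar>s\<bar>) + M0 * exp (lam * \<bar>s\<bar>)"
      using mult_left_mono[of 1 "exp (lam * \<bar>s\<bar>)" "K * N"] lam_pos K_nonneg N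
      by (intro add_mono F_zero_le) auto
    finally show ?thesis by (simp add: algebra_simps)
  qed
  define B where "B = norm a + (M0 + K * N) / lam + N + M * N"
  have B_nonneg: "0 \<le> B"
  proof -
    have "0 \<le> M0 * exp (lam * \<bar>0\<bar>)" using F_zero_le[of 0] norm_ge_zero order_trans by blast
    then show ?thesis using N K_nonneg M_nonneg lam_pos by (simp add: B_def)
  qed
  have c_le: "norm (c t) \<le> B * exp (- lam * t)" for t
  proof (cases "0 \<le> t")
    case True
    then show ?thesis using B_nonneg by (simp add: c_pos)
  next
    case False
    let ?e = "exp (- lam * t)"
    have e: "1 \<le> ?e" using False lam_pos by (simp add: mult_nonneg_nonpos)
    have "norm (g t) \<le> (M0 + K * N) / lam * exp (lam * \<bar>t\<bar>)"
      using False by (intro primitive_at_0_le[OF lam_pos g g0] F_le)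
        (auto simp: closed_segment_eq_real_ivl)
    then have g_le: "norm (g t) \<le> (M0 + K * N) / lam * ?e" using False by simp
    have L_seg: "norm (L t (seg r X t)) \<le> M * N"
      using L_le[OF segI[OF X]] mult_left_mono[OF segX_le M_nonneg, of t] False
      by (meson le_cases order_trans)
    have "norm (c t) \<le> norm a + (M0 + K * N) / lam * ?e + (N + M * N)"
      unfolding c_def using False N g_le L_seg
      by (intro norm_triangle_le_diff norm_triangle_le add_mono) auto
    also have "\<dots> \<le> norm a * ?e + (M0 + K * N) / lam * ?e + (N + M * N) * ?e"
      using e N M_nonneg mult_left_mono[OF e, of "norm a"] mult_left_mono[OF e, of "N + M * N"] by simp
    finally show ?thesis by (simp add: B_def algebra_simps)
  qed
  obtain z p B' where z: "continuous_on UNIV z" and z_le: "\<And>t. norm (z t) \<le> B' * exp (- lam * t)"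
    and p: "\<And>t. (p has_vector_derivative F t (seg r (\<lambda>s. X s + z s) t) - F t (seg r X t)) (at t)"
    and zp: "\<And>t. z t - (L t (seg r (\<lambda>s. X s + z s) t) - L t (seg r X t)) = c t + p t"
  proof (rule weighted_perturbation_exists[where w = "\<lambda>t. exp (- lam * t)" and A = at_top,
        OF _ _ decay_weight_lag _ _ X c c_le])
    fix f :: "real \<Rightarrow> 'a" and C
    assume "continuous_on UNIV f" "\<And>t. norm (f t) \<le> C * exp (- lam * t)"
    then obtain h where "(h \<longlongrightarrow> 0) at_top" "\<And>t. (h has_vector_derivative f t) (at t)"
      by (rule primitive_at_top_exists[OF lam_pos]) blast
    then show "\<exists>h. (h \<longlongrightarrow> 0) at_top \<and> (\<forall>t. (h has_vector_derivative f t) (at t))" by blast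
  next
    fix f h :: "real \<Rightarrow> 'a" and C t
    assume "\<And>t. (h has_vector_derivative f t) (at t)" "(h \<longlongrightarrow> 0) at_top"
      "\<And>t. norm (f t) \<le> C * exp (- lam * t)"
    then show "norm (h t) \<le> C / lam * exp (- lam * t)"
      by (rule primitive_at_top_le[OF lam_pos])
  qed (auto intro!: continuous_intros)
  let ?y = "\<lambda>s. X s + z s"
  have yp: "?y t - L t (seg r ?y t) = a + g t + p t" for t
    using zp[of t] by (simp add: c_def algebra_simps)
  show thesis
  proof (rule that[of ?y])
    show "solution_on_line r L F ?y"
    proof (rule solution_on_lineI)
      show "continuous_on UNIV ?y" by (intro continuous_intros X z)
      fix t
      have "((\<lambda>s. a + g s + p s) has_vector_derivative F t (seg r ?y t)) (at t)"
        by (auto intro!: derivative_eq_intros g p)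
      then show "((\<lambda>s. ?y s - L s (seg r ?y s)) has_vector_derivative F t (seg r ?y t)) (at t)"
        by (simp only: yp)
    qed
    show "bdd_above ((\<lambda>t. norm (?y t) * exp (lam * t)) ` {..0})"
    proof (rule weight_boundI)
      fix t :: real assume "t \<in> {..0}"
      then have t: "t \<le> 0" by simp
      have "N * 1 \<le> N * exp (- lam * t)"
        using N t lam_pos by (intro mult_left_mono) (auto simp: mult_nonneg_nonpos)
      then show "norm (?y t) \<le> (N + B') * exp (- lam * t)"
        using N(2)[OF t] z_le[of t] by (intro norm_triangle_le) (simp add: algebra_simps)
    qed
    show "norm (x t - ?y t) \<le> B' * exp (- lam * t)" if "0 \<le> t" for t
      using z_le[of t] that by (simp add: Xx)
  qed
qed

text \<open>
  For uniqueness, the solution belonging to another admissible \<open>\<xi>\<close> differs from the shadowing one by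
  \<open>O(exp (- \<lambda> t))\<close> both for \<open>t \<ge> 0\<close>, where both approach \<open>x\<close>, and for \<open>t \<le> 0\<close>, by the growth condition that
  defines \<open>\<Psi>\<close>.
\<close>

theorem asymptotic_phase:
  assumes x: "solution_from r L F \<phi> x"
  shows "\<exists>!\<xi>. bdd_above ((\<lambda>t. norm (x t - Psi r lam L F t \<xi>) * exp (lam * t)) ` {0..})"
proof -
  obtain y B where y: "solution_on_line r L F y"
    and y_bdd: "bdd_above ((\<lambda>t. norm (y t) * exp (lam * t)) ` {..0})"
    and y_le: "\<And>t. 0 \<le> t \<Longrightarrow> norm (x t - y t) \<le> B * exp (- lam * t)"
    by (rule shadowing_line_solution_exists[OF x]) blast
  show ?thesis
  proof (rule ex1I)
    show "bdd_above ((\<lambda>t. norm (x t - Psi r lam L F t (y 0 - L 0 (seg r y 0))) * exp (lam * t)) ` {0..})"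
      unfolding Psi_eqI[OF y y_bdd] by (rule weight_boundI[where B = B]) (use y_le in simp)
    fix \<xi>
    assume bdd: "bdd_above ((\<lambda>t. norm (x t - Psi r lam L F t \<xi>) * exp (lam * t)) ` {0..})"
    obtain v where v: "solution_on_line r L F v" and v0: "v 0 - L 0 (seg r v 0) = \<xi>"
      and v_bdd: "bdd_above ((\<lambda>t. norm (v t) * exp (lam * t)) ` {..0})"
      by (rule line_solution_exists) blast
    have Psi: "Psi r lam L F t \<xi> = v t" for t using Psi_eqI[OF v v_bdd] v0 by simp
    obtain Bp where Bp: "0 \<le> Bp" "\<And>t. t \<in> {0..} \<Longrightarrow> norm (x t - v t) \<le> Bp * exp (- lam * t)"
      by (rule weight_boundD[OF bdd[unfolded Psi]]) blast
    obtain By where By: "0 \<le> By" "\<And>t. t \<in> {..0} \<Longrightarrow> norm (y t) \<le> By * exp (- lam * t)"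
      by (rule weight_boundD[OF y_bdd]) blast
    obtain Bv where Bv: "0 \<le> Bv" "\<And>t. t \<in> {..0} \<Longrightarrow> norm (v t) \<le> Bv * exp (- lam * t)"
      by (rule weight_boundD[OF v_bdd]) blast
    have "norm (v t - y t) \<le> (Bp + \<bar>B\<bar> + By + Bv) * exp (- lam * t)" for t
    proof (cases "0 \<le> t")
      case True
      have "norm (v t - y t) = norm ((x t - y t) - (x t - v t))" by simp
      also have "\<dots> \<le> B * exp (- lam * t) + Bp * exp (- lam * t)"
        using True by (intro norm_triangle_le_diff add_mono Bp y_le) auto
      also have "\<dots> = (B + Bp) * exp (- lam * t)" by (simp add: algebra_simps)
      also have "\<dots> \<le> (Bp + \<bar>B\<bar> + By + Bv) * exp (- lam * t)"
        using By Bv by (intro mult_right_mono) auto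
      finally show ?thesis .
    next
      case False
      have "norm (v t - y t) \<le> Bv * exp (- lam * t) + By * exp (- lam * t)"
        using False by (intro norm_triangle_le_diff add_mono Bv By) auto
      also have "\<dots> = (Bv + By) * exp (- lam * t)" by (simp add: algebra_simps)
      also have "\<dots> \<le> (Bp + \<bar>B\<bar> + By + Bv) * exp (- lam * t)"
        using Bp by (intro mult_right_mono) auto
      finally show ?thesis .
    qed
    then have "v = y"
      by (rule decaying_difference_vanishes[OF v y]) (use Bp By Bv in simp)
    then show "\<xi> = y 0 - L 0 (seg r y 0)" using v0 by simp
  qed
qed

end

section \<open>Consequences of the hypothesis\<close>

lemma has_stieltjes_integral_combine:
  assumes f: "has_stieltjes_integral g f a b I" and h: "has_stieltjes_integral g h a b J"
  shows "has_stieltjes_integral g (\<lambda>\<theta>. c *\<^sub>R f \<theta> + d *\<^sub>R h \<theta>) a b (c *\<^sub>R I + d *\<^sub>R J)"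
  unfolding has_stieltjes_integral_def
proof (intro allI impI)
  fix e :: real assume e: "0 < e"
  define e' where "e' = e / (\<bar>c\<bar> + \<bar>d\<bar> + 1)"
  have e': "0 < e'" using e by (simp add: e'_def add_nonneg_pos)
  let ?S = "\<lambda>f p. \<Sum>(\<theta>, K)\<in>p. blinfun_apply (g (Sup K) - g (Inf K)) (f \<theta>)"
  obtain d1 where d1: "0 < d1" "\<And>p. p tagged_division_of {a..b} \<Longrightarrow> (\<lambda>\<theta>. ball \<theta> d1) fine p \<Longrightarrow>
      norm (?S f p - I) < e'"
    using f e' unfolding has_stieltjes_integral_def by meson
  obtain d2 where d2: "0 < d2" "\<And>p. p tagged_division_of {a..b} \<Longrightarrow> (\<lambda>\<theta>. ball \<theta> d2) fine p \<Longrightarrow>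
      norm (?S h p - J) < e'"
    using h e' unfolding has_stieltjes_integral_def by meson
  have "norm (?S (\<lambda>\<theta>. c *\<^sub>R f \<theta> + d *\<^sub>R h \<theta>) p - (c *\<^sub>R I + d *\<^sub>R J)) < e"
    if p: "p tagged_division_of {a..b}" "(\<lambda>\<theta>. ball \<theta> (min d1 d2)) fine p" for p
  proof -
    have fine: "(\<lambda>\<theta>. ball \<theta> d1) fine p" "(\<lambda>\<theta>. ball \<theta> d2) fine p"
      using p(2) by (force simp: fine_def)+
    have "?S (\<lambda>\<theta>. c *\<^sub>R f \<theta> + d *\<^sub>R h \<theta>) p = c *\<^sub>R ?S f p + d *\<^sub>R ?S h p"
      by (simp add: blinfun.add_right blinfun.scaleR_right sum.distrib scaleR_sum_right
          case_prod_unfold)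
    then have "?S (\<lambda>\<theta>. c *\<^sub>R f \<theta> + d *\<^sub>R h \<theta>) p - (c *\<^sub>R I + d *\<^sub>R J)
        = c *\<^sub>R (?S f p - I) + d *\<^sub>R (?S h p - J)"
      by (simp add: algebra_simps)
    also have "norm \<dots> \<le> \<bar>c\<bar> * e' + \<bar>d\<bar> * e'"
      using d1(2)[OF p(1) fine(1)] d2(2)[OF p(1) fine(2)]
      by (intro norm_triangle_le add_mono) (auto intro: mult_left_mono)
    also have "\<dots> < (\<bar>c\<bar> + \<bar>d\<bar> + 1) * e'" using e' by (simp add: algebra_simps)
    also have "\<dots> = e" by (simp add: e'_def)
    finally show ?thesis .
  qed
  then show "\<exists>d'>0. \<forall>p. p tagged_division_of {a..b} \<and> (\<lambda>\<theta>. ball \<theta> d') fine p \<longrightarrow>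
      norm (?S (\<lambda>\<theta>. c *\<^sub>R f \<theta> + d *\<^sub>R h \<theta>) p - (c *\<^sub>R I + d *\<^sub>R J)) < e"
    using d1(1) d2(1) by (intro exI[of _ "min d1 d2"]) auto
qed

text \<open>
  This has content because fine tagged divisions exist for every gauge (Cousin's lemma). With
  linearity it yields uniqueness of the integral, and thereby linearity of \<open>L(t)\<close>.
\<close>

lemma has_stieltjes_integral_zero:
  assumes "has_stieltjes_integral g (\<lambda>_. 0) a b I"
  shows "I = 0"
proof (rule ccontr)
  assume "I \<noteq> 0"
  then have "0 < norm I" by simp
  then obtain d where d: "0 < d" "\<And>p. p tagged_division_of {a..b} \<Longrightarrow> (\<lambda>\<theta>. ball \<theta> d) fine p \<Longrightarrow>
      norm ((\<Sum>(\<theta>, K)\<in>p. blinfun_apply (g (Sup K) - g (Inf K)) 0) - I) < norm I"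
    using assms unfolding has_stieltjes_integral_def by meson
  obtain p where "p tagged_division_of {a..b}" "(\<lambda>\<theta>. ball \<theta> d) fine p"
    using fine_division_exists_real[OF gauge_ball[OF d(1)]] by blast
  from d(2)[OF this] show False by (simp add: case_prod_unfold)
qed

lemma has_stieltjes_integral_unique:
  assumes "has_stieltjes_integral g f a b I" and "has_stieltjes_integral g f a b J"
  shows "I = J"
proof -
  have "has_stieltjes_integral g (\<lambda>_. 0) a b (I - J)"
    using has_stieltjes_integral_combine[OF assms, of 1 "- 1"] by simp
  from has_stieltjes_integral_zero[OF this] show ?thesis by simp
qed

lemma homogeneous_bound:
  fixes f :: "'c::real_normed_vector \<Rightarrow> 'b::real_normed_vector"
  assumes v: "v \<in> S" and scale: "\<And>a v. v \<in> S \<Longrightarrow> a *\<^sub>R v \<in> S \<and> f (a *\<^sub>R v) = a *\<^sub>R f v"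
    and unit: "\<And>v. v \<in> S \<Longrightarrow> norm v \<le> 1 \<Longrightarrow> norm (f v) \<le> B"
  shows "norm (f v) \<le> B * norm v"
proof (cases "v = 0")
  case True
  then show ?thesis using scale[OF v, of 0] by simp
next
  case False
  have "norm (f ((1 / norm v) *\<^sub>R v)) \<le> B"
    using False scale[OF v] by (intro unit) auto
  then show ?thesis using False scale[OF v] by (simp add: field_simps)
qed

context hypothesis_H
begin

lemma L_combine:
  fixes \<phi> \<psi> :: "real \<Rightarrow>\<^sub>C 'a"
  assumes "\<phi> \<in> Cspace r" and "\<psi> \<in> Cspace r"
  shows "L t (a *\<^sub>R \<phi> + b *\<^sub>R \<psi>) = a *\<^sub>R L t \<phi> + b *\<^sub>R L t \<psi>"
proof (rule has_stieltjes_integral_unique)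
  show "has_stieltjes_integral (\<eta> t) (apply_bcontfun (a *\<^sub>R \<phi> + b *\<^sub>R \<psi>)) (- r) 0
      (L t (a *\<^sub>R \<phi> + b *\<^sub>R \<psi>))"
    by (intro L_integral Cspace_combine assms)
  have "apply_bcontfun (a *\<^sub>R \<phi> + b *\<^sub>R \<psi>)
      = (\<lambda>\<theta>. a *\<^sub>R apply_bcontfun \<phi> \<theta> + b *\<^sub>R apply_bcontfun \<psi> \<theta>)"
    by auto
  then show "has_stieltjes_integral (\<eta> t) (apply_bcontfun (a *\<^sub>R \<phi> + b *\<^sub>R \<psi>)) (- r) 0
      (a *\<^sub>R L t \<phi> + b *\<^sub>R L t \<psi>)"
    using has_stieltjes_integral_combine[OF L_integral[OF assms(1)] L_integral[OF assms(2)]]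
    by simp
qed

lemma norm_L_le:
  fixes \<phi> :: "real \<Rightarrow>\<^sub>C 'a"
  assumes "\<phi> \<in> Cspace r"
  shows "norm (L t \<phi>) \<le> M * norm \<phi>"
proof (rule homogeneous_bound[OF assms])
  show "a *\<^sub>R \<psi> \<in> Cspace r \<and> L t (a *\<^sub>R \<psi>) = a *\<^sub>R L t \<psi>" if "\<psi> \<in> Cspace r" for a and \<psi> :: "real \<Rightarrow>\<^sub>C 'a"
    using Cspace_combine[OF that that, of a 0] L_combine[OF that that, of t a 0] by simp
  fix \<psi> :: "real \<Rightarrow>\<^sub>C 'a"
  assume "\<psi> \<in> Cspace r" "norm \<psi> \<le> 1"
  then have "ennreal (norm (L t \<psi>)) \<le> opnorm_on (Cspace r) (L t)"
    unfolding opnorm_on_def by (intro SUP_upper) simp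
  also have "\<dots> \<le> ennreal M"
    unfolding L_norm[symmetric] by (rule SUP_upper) simp
  finally show "norm (L t \<psi>) \<le> M" using M_range by simp
qed

lemma D1_combine:
  fixes \<phi> v w :: "real \<Rightarrow>\<^sub>C 'a"
  assumes "\<phi> \<in> Cspace r" and "v \<in> Cspace r" and "w \<in> Cspace r"
  shows "D 1 t \<phi> [a *\<^sub>R v + b *\<^sub>R w] = a *\<^sub>R D 1 t \<phi> [v] + b *\<^sub>R D 1 t \<phi> [w]"
proof -
  have "multilinear_on (Cspace r) 1 (D 1 t \<phi>)"
    using F_Ck k_ge_1 assms(1) by (simp add: Ck_with_derivs_def)
  then have "D 1 t \<phi> ([] @ (a *\<^sub>R v + b *\<^sub>R w) # [])
      = a *\<^sub>R D 1 t \<phi> ([] @ v # []) + b *\<^sub>R D 1 t \<phi> ([] @ w # [])"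
    unfolding multilinear_on_def using assms(2,3)
    by (metis add.left_neutral add.right_neutral empty_set empty_subsetI list.size(3))
  then show ?thesis by simp
qed

text \<open>
  Lists of length \<open>0\<close> have no norm constraint, so the \<open>0\<close>-linear operator norm is the norm of the value
  at the empty list, and the case \<open>j = 0\<close> of the \<open>C\<^sup>k\<close> condition is ordinary Frechet
  differentiability along \<open>S\<close>. It is used along lines only: they stay in the subspace, while \<open>F(t,\<cdot>)\<close> is
  uncontrolled off it.
\<close>

lemma F_has_directional_derivative:
  fixes \<phi> h :: "real \<Rightarrow>\<^sub>C 'a"
  assumes \<phi>: "\<phi> \<in> Cspace r" and h: "h \<in> Cspace r"
  shows "((\<lambda>s. F t (\<phi> + s *\<^sub>R h)) has_vector_derivative D 1 t (\<phi> + s *\<^sub>R h) [h]) (at s)"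
  unfolding has_vector_derivative_def has_derivative_at_alt
proof (intro conjI allI impI)
  show "bounded_linear (\<lambda>x. x *\<^sub>R D 1 t (\<phi> + s *\<^sub>R h) [h])"
    by (rule bounded_linear_scaleR_left)
  fix e :: real assume e: "0 < e"
  define \<phi>s where "\<phi>s = \<phi> + s *\<^sub>R h"
  have \<phi>s: "\<phi>s \<in> Cspace r" using Cspace_combine[OF \<phi> h, of 1 s] by (simp add: \<phi>s_def)
  \<comment> \<open>The summand \<open>1\<close> keeps the quotients meaningful for \<open>h = 0\<close>.\<close>
  define e' where "e' = e / (norm h + 1)"
  have e': "0 < e'" using e by (simp add: e'_def add_nonneg_pos)
  have D0: "D 0 t \<psi> [] = F t \<psi>" if "\<psi> \<in> Cspace r" for \<psi> :: "real \<Rightarrow>\<^sub>C 'a"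
    using F_Ck that by (simp add: Ck_with_derivs_def)
  have deriv: "\<forall>j<k. \<forall>\<phi>\<in>Cspace r. \<forall>\<epsilon>>0. \<exists>\<delta>>0. \<forall>h\<in>Cspace r. norm h < \<delta> \<longrightarrow>
      multi_opnorm_on (Cspace r) j (\<lambda>vs. D j t (\<phi> + h) vs - D j t \<phi> vs - D (Suc j) t \<phi> (h # vs))
        \<le> ennreal (\<epsilon> * norm h)"
    using F_Ck[of t] by (simp add: Ck_with_derivs_def)
  obtain \<delta> where \<delta>: "0 < \<delta>" "\<And>h. h \<in> Cspace r \<Longrightarrow> norm h < \<delta> \<Longrightarrow>
      multi_opnorm_on (Cspace r) 0 (\<lambda>vs. D 0 t (\<phi>s + h) vs - D 0 t \<phi>s vs - D (Suc 0) t \<phi>s (h # vs))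
        \<le> ennreal (e' * norm h)"
  proof -
    have "0 < k" using k_ge_1 by simp
    from deriv[rule_format, OF this \<phi>s e'] show thesis using that by blast
  qed
  have approx: "norm (F t (\<phi>s + v) - F t \<phi>s - D 1 t \<phi>s [v]) \<le> e' * norm v"
    if v: "v \<in> Cspace r" "norm v < \<delta>" for v
  proof -
    have "\<phi>s + v \<in> Cspace r" using Cspace_combine[OF \<phi>s v(1), of 1 1] by simp
    then have "ennreal (norm (F t (\<phi>s + v) - F t \<phi>s - D 1 t \<phi>s [v]))
        = ennreal (norm (D 0 t (\<phi>s + v) [] - D 0 t \<phi>s [] - D (Suc 0) t \<phi>s (v # [])))"
      using \<phi>s by (simp add: D0)
    also have "\<dots> \<le> multi_opnorm_on (Cspace r) 0
        (\<lambda>vs. D 0 t (\<phi>s + v) vs - D 0 t \<phi>s vs - D (Suc 0) t \<phi>s (v # vs))"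
      unfolding multi_opnorm_on_def by (rule SUP_upper) simp
    also have "\<dots> \<le> ennreal (e' * norm v)" by (rule \<delta>(2)[OF v])
    finally show ?thesis using e' by simp
  qed
  show "\<exists>d>0. \<forall>u. norm (u - s) < d \<longrightarrow>
      norm (F t (\<phi> + u *\<^sub>R h) - F t (\<phi> + s *\<^sub>R h) - (u - s) *\<^sub>R D 1 t (\<phi> + s *\<^sub>R h) [h])
        \<le> e * norm (u - s)"
  proof (intro exI[of _ "\<delta> / (norm h + 1)"] conjI allI impI)
    show "0 < \<delta> / (norm h + 1)" using \<delta>(1) by (simp add: add_nonneg_pos)
    fix u assume u: "norm (u - s) < \<delta> / (norm h + 1)"
    let ?v = "(u - s) *\<^sub>R h"
    have v: "?v \<in> Cspace r" using Cspace_combine[OF h h, of "u - s" 0] by simp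
    have pos: "0 < norm h + 1" by (simp add: add_nonneg_pos)
    have "norm ?v \<le> norm (u - s) * (norm h + 1)" by (simp add: mult_left_mono)
    also have "\<dots> < \<delta>" using u pos by (simp add: pos_less_divide_eq)
    finally have small: "norm ?v < \<delta>" .
    have "e' * norm ?v \<le> e' * (norm (u - s) * (norm h + 1))"
      using e' by (intro mult_left_mono) (auto simp: mult_left_mono)
    also have "\<dots> = e * norm (u - s)" using pos by (simp add: e'_def)
    finally have le: "e' * norm ?v \<le> e * norm (u - s)" .
    have D1: "D 1 t \<phi>s [?v] = (u - s) *\<^sub>R D 1 t \<phi>s [h]"
      using D1_combine[OF \<phi>s h h, of t "u - s" 0] by simp
    have "\<phi> + u *\<^sub>R h = \<phi>s + ?v" by (simp add: \<phi>s_def algebra_simps)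
    then show "norm (F t (\<phi> + u *\<^sub>R h) - F t (\<phi> + s *\<^sub>R h)
          - (u - s) *\<^sub>R D 1 t (\<phi> + s *\<^sub>R h) [h]) \<le> e * norm (u - s)"
      using order_trans[OF approx[OF v small] le] unfolding D1 by (simp only: \<phi>s_def)
  qed
qed

lemma norm_D1_le:
  fixes \<phi> h :: "real \<Rightarrow>\<^sub>C 'a"
  assumes \<phi>: "\<phi> \<in> Cspace r" and h: "h \<in> Cspace r"
  shows "norm (D 1 t \<phi> [h]) \<le> Mc 1 * norm h"
proof (rule homogeneous_bound[OF h, of "\<lambda>v. D 1 t \<phi> [v]"])
  show "a *\<^sub>R v \<in> Cspace r \<and> D 1 t \<phi> [a *\<^sub>R v] = a *\<^sub>R D 1 t \<phi> [v]" if "v \<in> Cspace r" for a and v :: "real \<Rightarrow>\<^sub>C 'a"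
    using Cspace_combine[OF that that, of a 0] D1_combine[OF \<phi> that that, of t a 0] by simp
  fix v :: "real \<Rightarrow>\<^sub>C 'a"
  assume v: "v \<in> Cspace r" "norm v \<le> 1"
  have "ennreal (norm (D 1 t \<phi> [v])) \<le> multi_opnorm_on (Cspace r) 1 (D 1 t \<phi>)"
    unfolding multi_opnorm_on_def using v by (intro SUP_upper) simp
  also have "\<dots> \<le> ennreal (Mc 1)" using F_derivs[OF _ k_ge_1 \<phi>] by simp
  finally show "norm (D 1 t \<phi> [v]) \<le> Mc 1" using Mc_pos[of 1] by simp
qed

lemma F_lipschitz_first:
  fixes \<phi> \<psi> :: "real \<Rightarrow>\<^sub>C 'a"
  assumes \<phi>: "\<phi> \<in> Cspace r" and \<psi>: "\<psi> \<in> Cspace r"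
  shows "norm (F t \<phi> - F t \<psi>) \<le> Mc 1 * norm (\<phi> - \<psi>)"
proof -
  define h where "h = \<phi> - \<psi>"
  have h: "h \<in> Cspace r" using Cspace_diff[OF assms] by (simp add: h_def)
  have on_line: "\<psi> + s *\<^sub>R h \<in> Cspace r" for s using Cspace_combine[OF \<psi> h, of 1 s] by simp
  note deriv = F_has_directional_derivative[OF \<psi> h, of t]
  have "norm (F t (\<psi> + 1 *\<^sub>R h) - F t (\<psi> + 0 *\<^sub>R h))
      \<le> (Mc 1 * norm h) * 1 - (Mc 1 * norm h) * 0"
  proof (rule differentiable_bound_general)
    show "continuous_on {0..1} (\<lambda>s. F t (\<psi> + s *\<^sub>R h))"
      using deriv by (meson continuous_at_imp_continuous_on has_vector_derivative_continuous)
    show "((\<lambda>s. (Mc 1 * norm h) * s) has_vector_derivative Mc 1 * norm h) (at s)" for s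
      by (auto intro!: derivative_eq_intros
          simp: has_real_derivative_iff_has_vector_derivative[symmetric])
  qed (use deriv norm_D1_le[OF on_line h] in \<open>auto intro!: continuous_intros simp del: One_nat_def\<close>)
  then show ?thesis by (simp add: h_def)
qed

text \<open>
  Otherwise the intermediate value theorem gives a further root of \<open>H(x) = M\<^sub>1 r\<^sub>0\<close> between \<open>x\<^sup>*\<close> and
  \<open>- ln M / (k + 1)\<close>, hence strictly between \<open>x\<^sub>1\<close> and \<open>x\<^sub>2\<close>.
\<close>

lemma Hfun_xstar: "Mc 1 * r0 < Hfun M xstar"
proof (rule ccontr)
  let ?b = "- ln M / (real k + 1)"
  assume "\<not> Mc 1 * r0 < Hfun M xstar"
  moreover have "continuous_on {xstar..?b} (Hfun M)"
    by (auto simp: Hfun_def[abs_def] intro!: continuous_intros)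
  ultimately have "\<exists>u. xstar \<le> u \<and> u \<le> ?b \<and> Hfun M u = Mc 1 * r0"
    using r0_small(2) xstar_range(1) by (intro IVT') (simp_all only: not_less less_imp_le greaterThanLessThan_iff)
  then obtain u where u: "xstar \<le> u" "u \<le> ?b" "Hfun M u = Mc 1 * r0" by blast
  have "u \<noteq> ?b" using u(3) r0_small by auto
  then have "u \<in> {x1<..<x2}" using u(1,2) xstar_range by auto
  moreover have "0 < x1" using roots(1) by auto
  ultimately have "u \<in> {x1, x2}" using u(3) unfolding roots(1)[symmetric] by auto
  then show False using \<open>u \<in> {x1<..<x2}\<close> by auto
qed

lemma xstar_pos: "0 < xstar"
proof -
  have "x1 \<in> {x. 0 < x \<and> Hfun M x = Mc 1 * r0}" unfolding roots(1) by simp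
  then show ?thesis using xstar_range(1) by simp
qed

lemma lam_pos: "0 < lam"
  using xstar_pos lam r_range by (metis zero_less_mult_pos)

text \<open>
  This is \<open>H(r \<lambda>) > M\<^sub>1 r\<close> divided by \<open>r \<lambda> exp (- r \<lambda>)\<close>.
\<close>

lemma contraction_gap: "exp (lam * r) * (M + Mc 1 / lam) < 1"
proof -
  have "Mc 1 * r \<le> Mc 1 * r0" using Mc_pos[of 1] r_range by simp
  also have "\<dots> < Hfun M (r * lam)" using Hfun_xstar lam by simp
  finally have "r * Mc 1 < r * (lam * (exp (- (r * lam)) - M))"
    by (simp add: Hfun_def algebra_simps)
  then have "Mc 1 < lam * (exp (- (r * lam)) - M)" using r_range by simp
  then have "M + Mc 1 / lam < exp (- (r * lam))" using lam_pos by (simp add: field_simps)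
  then have "exp (lam * r) * (M + Mc 1 / lam) < exp (lam * r) * exp (- (r * lam))" by simp
  also have "\<dots> = 1" by (simp add: exp_add[symmetric])
  finally show ?thesis .
qed

lemma neutral: "neutral_equation M (Mc 1) (Mc 0) r lam L F"
proof
  show "L t (\<phi> - \<psi>) = L t \<phi> - L t \<psi>" if "\<phi> \<in> Cspace r" "\<psi> \<in> Cspace r" for t \<phi> \<psi>
    using L_combine[OF that, of t 1 "- 1"] by simp
qed (use r_range M_range Mc_pos[of 1] in \<open>auto intro: lam_pos contraction_gap norm_L_le L_continuous
    F_continuous F_lipschitz_first F_zero
    simp del: One_nat_def\<close>)

end

theorem theorem2p2:
  fixes n k :: nat and M :: real and Mc :: "nat \<Rightarrow> real"
    and r0 x1 x2 xstar r lam :: real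
    and \<eta> :: "real \<Rightarrow> real \<Rightarrow> ('a::banach \<Rightarrow>\<^sub>L 'a)"
    and L :: "real \<Rightarrow> (real \<Rightarrow>\<^sub>C 'a) \<Rightarrow> 'a"
    and F :: "real \<Rightarrow> (real \<Rightarrow>\<^sub>C 'a) \<Rightarrow> 'a"
    and D :: "nat \<Rightarrow> real \<Rightarrow> (real \<Rightarrow>\<^sub>C 'a) \<Rightarrow> (real \<Rightarrow>\<^sub>C 'a) list \<Rightarrow> 'a"
    and \<phi> :: "real \<Rightarrow>\<^sub>C 'a" and x :: "real \<Rightarrow> 'a"
  assumes H: "hypothesis_H n k M Mc r0 x1 x2 xstar r lam \<eta> L F D"
    and \<phi>: "\<phi> \<in> Cspace r"
    and x: "solution_from r L F \<phi> x"
  shows "\<exists>!\<xi>. bdd_above ((\<lambda>t. norm (x t - Psi r lam L F t \<xi>) * exp (lam * t)) ` {0..})"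
proof -
  interpret hypothesis_H n k M Mc r0 x1 x2 xstar r lam \<eta> L F D by (rule H)
  interpret neutral_equation M "Mc 1" "Mc 0" r lam L F by (rule neutral)
  show ?thesis by (rule asymptotic_phase[OF x])
qed

end
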